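(* Let $a>0$, let $K\ge0$ be an integer, let $s(x)=-\log|x|$, and let $\tau$ be a smooth function on $[-a,a]$. Let $\eta\in C^p_c([-a,a])$ with $p>2K+1$ be even and satisfy $$\eta(0)=1,\qquad \eta^{(k)}(0)=0,\quad k=1,2,\dots,2K+1.$$ Let $w_0,\dots,w_K$ be the solution of the linear system $$\sum_{j=0}^K w_j\,j^{2k}=-\zeta'(-2k),\qquad k=0,1,\dots,K,$$ where $0^0:=1$ and $\zeta'$ is the derivative of the Riemann zeta function. Then one has the locally corrected trapezoidal rule $$I[s\cdot\tau\cdot\eta]=T_h^0[s\cdot\tau\cdot\eta]-\tau(0)\,h\log h+h\sum_{j=0}^K w_j\big(\tau(jh)+\tau(-jh)\big)+O(h^{2K+2})$$ as $h\to0^+$.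
   Context: For a function $g$ on $[-a,a]$, possibly singular at $0$, $I[g]:=\int_{-a}^a g(x)\,\mathrm{d}x$. The punctured trapezoidal rule is $$T_h^0[g]:=\sum_{\substack{n=-M\\ n\ne0}}^{M} g(nh)\,h,\qquad h=\frac{a}{M+\frac12},$$ where $M>0$ is an integer; the limit $h\to0^+$ means $M\to\infty$ (with $M\ge K$, so that the points $\pm jh$, $0\le j\le K$, lie in $[-a,a]$). $C^p_c([-a,a])$ denotes the $p$-times continuously differentiable functions compactly supported in $[-a,a]$. *)

theory Defs
  imports "HOL-Complex_Analysis.Complex_Analysis" "HOL-Library.Landau_Symbols"
begin

(* The analytic continuation of the Dirichlet series to the complex plane without 1.
   By the identity theorem (the domain is connected) this fixes the function everywhere
   except at the pole 1, where its value is arbitrary. *)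
definition riemann_zeta :: "complex \<Rightarrow> complex" where
  "riemann_zeta = (SOME f. f holomorphic_on (- {1}) \<and>
     (\<forall>s. Re s > 1 \<longrightarrow> (\<lambda>n. of_nat (Suc n) powr (- s)) sums f s))"

(* Derivatives are taken relative to S, so they are one-sided at the end points of a
   closed interval. *)
primrec C_on :: "nat \<Rightarrow> real set \<Rightarrow> (real \<Rightarrow> real) \<Rightarrow> bool" where
  "C_on 0 S f \<longleftrightarrow> continuous_on S f"
| "C_on (Suc p) S f \<longleftrightarrow>
     (\<exists>f'. (\<forall>x\<in>S. (f has_real_derivative f' x) (at x within S)) \<and> C_on p S f')"

definition smooth_on :: "real set \<Rightarrow> (real \<Rightarrow> real) \<Rightarrow> bool" where
  "smooth_on S f \<longleftrightarrow> (\<forall>p. C_on p S f)"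

(* Functions are defined on the whole real line and vanish outside S; for S = {-a..a} the
   derivatives up to order p therefore also vanish at the end points. *)
definition C_compact :: "nat \<Rightarrow> real set \<Rightarrow> (real \<Rightarrow> real) set" where
  "C_compact p S =
     {f. C_on p UNIV f \<and> compact (closure {x. f x \<noteq> 0}) \<and> closure {x. f x \<noteq> 0} \<subseteq> S}"

definition step_size :: "real \<Rightarrow> nat \<Rightarrow> real" where
  "step_size a M = a / (real M + 1 / 2)"

definition punctured_trapezoidal :: "real \<Rightarrow> nat \<Rightarrow> (real \<Rightarrow> real) \<Rightarrow> real" where
  "punctured_trapezoidal a M g =
     (\<Sum>n\<in>{- int M..int M} - {0}. g (of_int n * step_size a M) * step_size a M)"

end

(* The trapezoidal rule is compared with the Euler-Maclaurin formula for cells of length h centred at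
   the nodes. Its coefficients are those of t / (2 sinh (t / 2)); they make the formula exact on
   polynomials, so Taylor expansion bounds the error of a cell by the derivative of order q + 1 of
   the antiderivative, where q = 2 K + 2. Applied to x^(-s), the formula continues the zeta function
   to Re s > 1 - q, and differentiating in s shows that -zeta'(-2 k) is the regularised value of the
   sum of n^(2 k) ln n. Evenness of the coefficients leaves ln h with the regularised value of the
   sum of n^(2 k), which is -1/2 for k = 0 and 0 otherwise.
   With F y = eta y * (tau y + tau (-y)), the integral is that of -ln y * F y over [0, a]. At 0, F is
   an even polynomial of degree 2 K plus a remainder R of order y^q. The polynomial part contributes
   the zeta values, ln * R contributes O(h^q), and the boundary terms at a = (M + 1/2) h cancel since
   F is flat there. *)
theory Submission imports Defs begin

section \<open>Midpoint Euler--Maclaurin formula\<close>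

text \<open>The step a / (M + 1/2) makes the cells around h, ..., M h tile [h/2, a] exactly, so 0
  lies in the one cell that the puncture removes. Each chain starts with an antiderivative: the
  integral is then the boundary term of order 0, and no integral remainder has to be estimated. The
  obstacle is that ln * R need not be smooth at 0: its derivative of order q can be unbounded.
  Trading |ln x| for a multiple of 1 / sqrt x keeps all bounds powers of x; the cell errors are then
  of size h^(q+1) / sqrt (n h), and summing them loses exactly one factor h. The correction sum is
  expanded on its own: the derivatives of eta of order 1 to q - 1 vanish at 0, so tau y + tau (-y)
  has the Taylor coefficients of F below order q, and the linear system for w turns the sum into the
  same zeta values up to O(h^q). As \<open>riemann_zeta\<close> is a choice among functions, a
  continuation has to be constructed first, already to know that the choice has a witness.\<close>

definition em_coeff :: "nat \<Rightarrow> real" where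
  "em_coeff j = fps_nth (fps_X / (fps_exp (1/2) - fps_exp (- 1/2))) j"

definition em_diff :: "nat \<Rightarrow> real" where
  "em_diff i = ((1/2) ^ i - (- 1/2) ^ i) / fact i"

text \<open>Cauchy product with 2 sinh (t/2), whose coefficients are \<open>em_diff\<close>;
  \<open>em_coeff j\<close> is B_j(1/2) / j! with the Bernoulli polynomial B_j. Since
  \<open>em_diff i\<close> is the increment of x^i / i! over the unit cell, this is exactness on x^m
  / m!, whose derivative at 0 is nonzero only for m = 1.\<close>

lemma em_coeff_conv: "(\<Sum>j\<le>m. em_coeff j * em_diff (m - j)) = (if m = 1 then 1 else 0)"
proof -
  let ?D = "fps_exp (1/2) - fps_exp (- 1/2) :: real fps"
  have D1: "fps_nth ?D 1 = 1" and D0: "fps_nth ?D 0 = 0" by simp_all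
  have D: "?D \<noteq> 0" using D1 by force
  \<comment> \<open>The denominator has no constant term and is no unit; the division is exact only
    because its lowest term has degree 1, as that of \<open>fps_X\<close>.\<close>
  have "subdegree ?D = 1"
    by (rule subdegreeI) (use D0 D1 in auto)
  then have "?D dvd fps_X"
    by (subst fps_dvd_iff) (use D in auto)
  then have "(fps_X / ?D) * ?D = fps_X" by simp
  then have "fps_nth ((fps_X / ?D) * ?D) m = (if m = 1 then 1 else 0)" by (simp add: fps_X_def)
  then show ?thesis
    by (simp add: fps_mult_nth em_coeff_def em_diff_def diff_divide_distrib atLeast0AtMost)
qed

lemma em_diff_0 [simp]: "em_diff 0 = 0" and em_diff_1 [simp]: "em_diff (Suc 0) = 1"
  by (simp_all add: em_diff_def)

text \<open>The system is triangular: \<open>em_diff 0 = 0\<close> removes the top index, and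
  \<open>em_diff 1 = 1\<close> makes \<open>b j\<close> the leading term of equation
  \<open>Suc j\<close>.\<close>

lemma em_coeff_unique:
  assumes "\<And>m. (\<Sum>j\<le>m. b j * em_diff (m - j)) = (if m = 1 then 1 else 0)"
  shows "b j = em_coeff j"
proof (induction j rule: less_induct)
  case (less j)
  have e: "(\<Sum>i\<le>Suc j. c i * em_diff (Suc j - i)) = c j + (\<Sum>i<j. c i * em_diff (Suc j - i))"
    for c :: "nat \<Rightarrow> real"
    by (simp add: lessThan_Suc_atMost[symmetric] Suc_diff_le)
  have "(\<Sum>i<j. b i * em_diff (Suc j - i)) = (\<Sum>i<j. em_coeff i * em_diff (Suc j - i))"
    using less by (intro sum.cong) auto
  then show ?case
    using e[of b] e[of em_coeff] assms[of "Suc j"] em_coeff_conv[of "Suc j"] by simp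
qed

lemma em_coeff_0 [simp]: "em_coeff 0 = 1"
  using em_coeff_conv[of 1] by simp

text \<open>t / (2 sinh (t/2)) is even. In terms of coefficients: \<open>em_diff\<close> vanishes at
  even indices, so changing the signs of the odd coefficients yields another solution of the same
  triangular system.\<close>

lemma em_coeff_odd:
  assumes "odd j"
  shows "em_coeff j = 0"
proof -
  have d: "(-1) ^ i * em_diff i = - em_diff i" for i
    by (cases "even i") (auto simp: em_diff_def)
  have "(-1) ^ j * em_coeff j = em_coeff j"
  proof (rule em_coeff_unique)
    fix m :: nat
    have "(-1) ^ j * em_coeff j * em_diff (m - j) = - ((-1) ^ m * (em_coeff j * em_diff (m - j)))"
      if "j \<le> m" for j
    proof -
      have "(-1) ^ m = (-1) ^ j * ((-1::real) ^ (m - j))"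
        using that by (simp flip: power_add)
      moreover have "(-1::real) ^ (m-j) * (em_diff (m-j)) = - em_diff (m-j)" by (rule d)
      ultimately show ?thesis by (simp add: mult_ac)
    qed
    then have "(\<Sum>j\<le>m. (-1) ^ j * em_coeff j * em_diff (m - j))
        = - ((-1) ^ m * (\<Sum>j\<le>m. em_coeff j * em_diff (m - j)))"
      by (simp add: sum_distrib_left flip: sum_negf)
    then show "(\<Sum>j\<le>m. (-1) ^ j * em_coeff j * em_diff (m - j)) = (if m = 1 then 1 else 0)"
      by (simp add: em_coeff_conv)
  qed
  with assms show ?thesis by simp
qed

text \<open>A family with $r_j' = r_{j+1}$ stands for a function and its derivatives.\<close>

lemma chain_flat_bound:
  fixes r :: "nat \<Rightarrow> real \<Rightarrow> 'a :: real_normed_vector"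
  assumes der: "\<And>j x. \<lbrakk>j < n; x \<in> S\<rbrakk> \<Longrightarrow> (r j has_vector_derivative r (Suc j) x) (at x within S)"
    and S: "convex S" "0 \<in> S" and r0: "\<And>j. j < n \<Longrightarrow> r j 0 = 0"
    and B: "\<And>x. x \<in> S \<Longrightarrow> norm (r n x) \<le> B"
    and "j \<le> n" "x \<in> S"
  shows "norm (r j x) \<le> B * \<bar>x\<bar> ^ (n - j)"
  using \<open>j \<le> n\<close> \<open>x \<in> S\<close>
proof (induction j arbitrary: x rule: inc_induct)
  case base
  then show ?case using B by simp
next
  case (step j)
  let ?C = "closed_segment 0 x"
  have sub: "?C \<subseteq> S"
    using S step.prems by (simp add: closed_segment_subset)
  have B0: "B \<ge> 0" using B[OF S(2)] norm_ge_zero order_trans by blast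
  have "norm (r j x - r j 0) \<le> (B * \<bar>x\<bar> ^ (n - Suc j)) * norm (x - 0)"
  proof (rule differentiable_bound[where f = "r j" and S = ?C and f' = "\<lambda>y h. h *\<^sub>R r (Suc j) y"])
    fix y assume y: "y \<in> ?C"
    show "(r j has_derivative (\<lambda>h. h *\<^sub>R r (Suc j) y)) (at y within ?C)"
      using der[OF step.hyps(2), of y] sub y
      by (auto simp: has_vector_derivative_def intro: has_derivative_subset)
    have "\<bar>y\<bar> \<le> \<bar>x\<bar>" using y by (auto simp: closed_segment_eq_real_ivl split: if_splits)
    then have "norm (r (Suc j) y) \<le> B * \<bar>x\<bar> ^ (n - Suc j)"
      using step.IH[of y] sub y B0
      by (meson mult_left_mono order_trans power_mono abs_ge_zero subsetD)
    then show "onorm (\<lambda>h. h *\<^sub>R r (Suc j) y) \<le> B * \<bar>x\<bar> ^ (n - Suc j)"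
      by (intro onorm_le) (simp add: mult.commute mult_left_mono)
  qed auto
  also have "\<dots> = B * \<bar>x\<bar> ^ (n - j)"
    using step.hyps by (simp add: Suc_diff_Suc flip: power_Suc2)
  finally show ?case using r0 step.hyps by simp
qed

text \<open>The number of terms drops with j, so that the Taylor polynomials of the members of a
  chain form a chain themselves, and so do the remainders.\<close>

lemma taylor_chain:
  fixes g :: "nat \<Rightarrow> real \<Rightarrow> 'a :: real_normed_vector"
  shows "((\<lambda>x. \<Sum>i<n - j. (x ^ i / fact i) *\<^sub>R c (j + i)) has_vector_derivative
           (\<Sum>i<n - Suc j. (x ^ i / fact i) *\<^sub>R c (Suc j + i))) (at x within S)"
proof -
  have "((\<lambda>x. \<Sum>i<n - j. (x ^ i / fact i) *\<^sub>R c (j + i)) has_vector_derivative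
           (\<Sum>i<n - j. (real i * x ^ (i - 1) / fact i) *\<^sub>R c (j + i))) (at x within S)"
    by (rule has_vector_derivative_sum, rule has_vector_derivative_eq_rhs,
        rule has_vector_derivative_scaleR, rule DERIV_cdivide, rule DERIV_pow,
        rule has_vector_derivative_const) simp
  moreover have "(\<Sum>i<n - j. (real i * x ^ (i - 1) / fact i) *\<^sub>R c (j + i))
      = (\<Sum>i<n - Suc j. (x ^ i / fact i) *\<^sub>R c (Suc j + i))"
  proof (cases "n - j")
    case (Suc k)
    then have k: "n - Suc j = k" by simp
    have "(real (Suc i) * x ^ i / fact (Suc i)) = x ^ i / fact i" for i
      by (simp add: divide_simps)
    then show ?thesis unfolding Suc k by (subst sum.lessThan_Suc_shift) simp
  qed simp
  ultimately show ?thesis by simp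
qed

section \<open>Error on one cell and on a row of cells\<close>

definition em_const :: "nat \<Rightarrow> real" where
  "em_const q = 1 + (\<Sum>j\<le>q. 2 * \<bar>em_coeff j\<bar>)"

lemma em_const_nonneg: "em_const q \<ge> 0"
  unfolding em_const_def by (intro add_nonneg_nonneg sum_nonneg) auto

lemma em_cell_unit:
  fixes g :: "nat \<Rightarrow> real \<Rightarrow> 'a :: real_normed_vector"
  assumes der: "\<And>j x. \<lbrakk>j \<le> q; \<bar>x\<bar> \<le> 1/2\<rbrakk> \<Longrightarrow>
       (g j has_vector_derivative g (Suc j) x) (at x within {-1/2..1/2})"
    and B: "\<And>x. \<bar>x\<bar> \<le> 1/2 \<Longrightarrow> norm (g (Suc q) x) \<le> B" and "q \<ge> 1"
  shows "norm (g 1 0 - (\<Sum>j\<le>q. em_coeff j *\<^sub>R (g j (1/2) - g j (-1/2)))) \<le> em_const q * B"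
proof -
  define p where "p j x = (\<Sum>i<Suc q - j. (x ^ i / fact i) *\<^sub>R g (j + i) 0)" for j x
  define r where "r j x = g j x - p j x" for j x
  have p_exact: "p 1 0 = (\<Sum>j\<le>q. em_coeff j *\<^sub>R (p j (1/2) - p j (-1/2)))"
  proof -
    have "p 1 0 = g 1 0"
    proof -
      obtain k where "q = Suc k" using \<open>q \<ge> 1\<close> by (cases q) auto
      then show ?thesis unfolding p_def by (simp add: sum.lessThan_Suc_shift del: sum.lessThan_Suc)
    qed
    have "(\<Sum>j\<le>q. em_coeff j *\<^sub>R (p j (1/2) - p j (-1/2)))
       = (\<Sum>j<Suc q. \<Sum>i<Suc q - j. (em_coeff j * em_diff i) *\<^sub>R g (j + i) 0)"
      unfolding lessThan_Suc_atMost[symmetric] p_def em_diff_def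
      by (simp add: scaleR_sum_right algebra_simps diff_divide_distrib del: sum.lessThan_Suc flip: sum_subtractf)
    also have "\<dots> = (\<Sum>(j,i)\<in>{(j,i). j + i < Suc q}. (em_coeff j * em_diff i) *\<^sub>R g (j + i) 0)"
      by (subst sum.Sigma) (auto intro!: sum.cong)
    \<comment> \<open>Grouping by the total order m = i + j brings each derivative of g at 0
      together with its convolution.\<close>
    also have "\<dots> = (\<Sum>m<Suc q. \<Sum>j\<le>m. (em_coeff j * em_diff (m - j)) *\<^sub>R g m 0)"
      by (subst sum.triangle_reindex) simp
    also have "\<dots> = (\<Sum>m<Suc q. (if m = 1 then g m 0 else 0))"
      unfolding scaleR_sum_left[symmetric] em_coeff_conv by (intro sum.cong) auto
    also have "\<dots> = g 1 0"
      using \<open>q \<ge> 1\<close> by (subst sum.delta) auto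
    finally show ?thesis using \<open>p 1 0 = g 1 0\<close> by simp
  qed
  have rB: "norm (r j x) \<le> B" if "j \<le> q" "\<bar>x\<bar> \<le> 1/2" for j x
  proof -
    have "norm (r j x) \<le> B * \<bar>x\<bar> ^ (Suc q - j)"
    proof (rule chain_flat_bound[where S = "{-1/2..1/2}"])
      fix i x assume "i < Suc q" "x \<in> {-1/2..1/2::real}"
      then show "(r i has_vector_derivative r (Suc i) x) (at x within {-1/2..1/2})"
        unfolding r_def p_def
        by (intro has_vector_derivative_diff der taylor_chain) auto
    next
      fix i assume "i < Suc q"
      then obtain k where "Suc q - i = Suc k" by (cases "Suc q - i") auto
      then show "r i 0 = 0" unfolding r_def p_def
        by (simp add: sum.lessThan_Suc_shift del: sum.lessThan_Suc)
    next
      fix x :: real assume "x \<in> {-1/2..1/2}"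
      then show "norm (r (Suc q) x) \<le> B" using B[of x] by (auto simp: r_def p_def abs_if)
    qed (use that in auto)
    also have "\<dots> \<le> B * 1"
      using B[of 0] that by (intro mult_left_mono power_le_one) (auto intro: order_trans[OF norm_ge_zero])
    finally show ?thesis by simp
  qed
  have "g 1 0 - (\<Sum>j\<le>q. em_coeff j *\<^sub>R (g j (1/2) - g j (-1/2)))
      = r 1 0 - (\<Sum>j\<le>q. em_coeff j *\<^sub>R (r j (1/2) - r j (-1/2)))"
    using p_exact unfolding r_def by (simp add: algebra_simps sum_subtractf sum.distrib)
  also have "norm \<dots> \<le> norm (r 1 0) + norm (\<Sum>j\<le>q. em_coeff j *\<^sub>R (r j (1/2) - r j (-1/2)))"
    by (rule norm_triangle_ineq4)
  \<comment> \<open>Source of \<open>em_const\<close>: one remainder at the centre and, for each j,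
    two at the end points.\<close>
  also have "\<dots> \<le> B + (\<Sum>j\<le>q. \<bar>em_coeff j\<bar> * (B + B))"
  proof (intro add_mono sum_norm_le)
    show "norm (r 1 0) \<le> B" using rB[of 1 0] \<open>q \<ge> 1\<close> by simp
    fix j assume "j \<in> {..q}"
    then have "norm (r j (1/2) - r j (-1/2)) \<le> B + B"
      using rB[of j "1/2"] rB[of j "-1/2"] by (intro order_trans[OF norm_triangle_ineq4] add_mono) auto
    then show "norm (em_coeff j *\<^sub>R (r j (1/2) - r j (-1/2))) \<le> \<bar>em_coeff j\<bar> * (B + B)"
      unfolding norm_scaleR by (intro mult_left_mono) auto
  qed
  also have "\<dots> = em_const q * B"
    by (simp add: em_const_def algebra_simps sum_distrib_left)
  finally show ?thesis .
qed

text \<open>Substitution x = c + h t: each derivative in t brings out a factor h, so the bound for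
  the member of index q + 1 acquires h^(q+1).\<close>

lemma em_cell:
  fixes g :: "nat \<Rightarrow> real \<Rightarrow> 'a :: real_normed_vector"
  assumes h: "h > 0"
    and der: "\<And>j x. \<lbrakk>j \<le> q; x \<in> {c - h/2..c + h/2}\<rbrakk> \<Longrightarrow>
       (g j has_vector_derivative g (Suc j) x) (at x within {c - h/2..c + h/2})"
    and B: "\<And>x. x \<in> {c - h/2..c + h/2} \<Longrightarrow> norm (g (Suc q) x) \<le> B" and "q \<ge> 1"
  shows "norm (h *\<^sub>R g 1 c - (\<Sum>j\<le>q. (em_coeff j * h ^ j) *\<^sub>R (g j (c + h/2) - g j (c - h/2))))
           \<le> em_const q * (h ^ Suc q * B)"
proof -
  define f where "f j t = h ^ j *\<^sub>R g j (c + h * t)" for j t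
  have mem: "c + h * t \<in> {c - h/2..c + h/2}" if "\<bar>t\<bar> \<le> 1/2" for t
  proof -
    have "\<bar>h * t\<bar> \<le> h / 2" using that h by (simp add: abs_mult)
    then show ?thesis by (auto simp: abs_le_iff)
  qed
  have "norm (f 1 0 - (\<Sum>j\<le>q. em_coeff j *\<^sub>R (f j (1/2) - f j (-1/2)))) \<le> em_const q * (h ^ Suc q * B)"
  proof (rule em_cell_unit)
    fix j and t :: real assume j: "j \<le> q" and t: "\<bar>t\<bar> \<le> 1/2"
    let ?T = "{-1/2..1/2::real}"
    have "((\<lambda>t. c + h * t) has_vector_derivative h) (at t within ?T)"
      by (auto intro!: derivative_eq_intros)
    moreover have "(\<lambda>t. c + h * t) ` ?T \<subseteq> {c - h/2..c + h/2}"
      by (intro image_subsetI mem) (auto simp: abs_le_iff)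
    then have "(g j has_vector_derivative g (Suc j) (c + h * t)) (at (c + h * t) within (\<lambda>t. c + h * t) ` ?T)"
      by (rule has_vector_derivative_within_subset[OF der[OF j mem[OF t]]])
    ultimately have "((g j \<circ> (\<lambda>t. c + h * t)) has_vector_derivative h *\<^sub>R g (Suc j) (c + h * t)) (at t within ?T)"
      by (rule vector_diff_chain_within)
    from has_vector_derivative_scaleR[OF DERIV_const[of "h^j"] this]
    show "(f j has_vector_derivative f (Suc j) t) (at t within ?T)"
      by (simp add: f_def[abs_def] o_def mult.commute)
  next
    fix t :: real assume t: "\<bar>t\<bar> \<le> 1/2"
    show "norm (f (Suc q) t) \<le> h ^ Suc q * B"
      using B[OF mem[OF t]] h unfolding f_def norm_scaleR by (intro mult_mono) auto
  qed fact
  then show ?thesis by (simp add: f_def algebra_simps)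
qed

text \<open>The boundary terms of adjacent cells telescope. The bound may differ from cell to cell,
  because the derivatives to be estimated blow up towards 0.\<close>

lemma em_sum:
  fixes g :: "nat \<Rightarrow> real \<Rightarrow> 'a :: real_normed_vector"
  assumes h: "h > 0" and q: "q \<ge> 1"
    and der: "\<And>j x. \<lbrakk>j \<le> q; x \<in> {h/2..(real M + 1/2) * h}\<rbrakk> \<Longrightarrow>
       (g j has_vector_derivative g (Suc j) x) (at x within {h/2..(real M + 1/2) * h})"
    and B: "\<And>n x. \<lbrakk>n \<in> {1..M}; x \<in> {real n * h - h/2..real n * h + h/2}\<rbrakk> \<Longrightarrow> norm (g (Suc q) x) \<le> B n"
  shows "norm ((\<Sum>n=1..M. h *\<^sub>R g 1 (real n * h))
            - (\<Sum>j\<le>q. (em_coeff j * h ^ j) *\<^sub>R (g j ((real M + 1/2) * h) - g j (h/2))))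
           \<le> em_const q * (h ^ Suc q * (\<Sum>n=1..M. B n))"
proof -
  define T where "T x = (\<Sum>j\<le>q. (em_coeff j * h ^ j) *\<^sub>R g j x)" for x
  have cell: "norm (h *\<^sub>R g 1 (real n * h) - (T (real n * h + h/2) - T (real n * h - h/2)))
       \<le> em_const q * (h ^ Suc q * B n)" if n: "n \<in> {1..M}" for n
  proof -
    have "h \<le> real n * h" "real n * h \<le> real M * h" using n h by simp_all
    then have sub: "{real n * h - h/2..real n * h + h/2} \<subseteq> {h/2..(real M + 1/2) * h}"
      by (auto simp: algebra_simps)
    show ?thesis
      unfolding T_def sum_subtractf[symmetric] scaleR_diff_right[symmetric]
      by (rule em_cell[OF h _ _ q])
         (use B[OF n] in \<open>auto intro!: has_vector_derivative_within_subset[OF der sub] subsetD[OF sub] simp del: atLeastAtMost_iff\<close>)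
  qed
  have tele: "(\<Sum>n=1..N. T (real n * h + h/2) - T (real n * h - h/2)) = T ((real N + 1/2) * h) - T (h/2)" for N
    by (induction N) (simp_all add: algebra_simps add_divide_distrib)
  have "norm (\<Sum>n=1..M. h *\<^sub>R g 1 (real n * h) - (T (real n * h + h/2) - T (real n * h - h/2)))
      \<le> (\<Sum>n=1..M. em_const q * (h ^ Suc q * B n))"
    by (rule sum_norm_le) (rule cell)
  then show ?thesis
    unfolding sum_subtractf[of "\<lambda>n. h *\<^sub>R g 1 (real n * h)"] tele
    by (simp add: T_def sum_distrib_left flip: sum_subtractf scaleR_diff_right)
qed

section \<open>Analytic continuation of the zeta function\<close>

text \<open>Coefficient in the j-th derivative of x^(1-s) / (1-s); away from s = 1 the denominator
  cancels from j = 1 on. The field is left open: s is complex for the zeta function and the real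
  number -2k for the power sums.\<close>

primrec antideriv_coeff :: "nat \<Rightarrow> 'a :: field \<Rightarrow> 'a" where
  "antideriv_coeff 0 s = inverse (1 - s)"
| "antideriv_coeff (Suc j) s = antideriv_coeff j s * (1 - s - of_nat j)"

primrec antideriv_coeff' :: "nat \<Rightarrow> 'a :: field \<Rightarrow> 'a" where
  "antideriv_coeff' 0 s = inverse (1 - s) ^ 2"
| "antideriv_coeff' (Suc j) s = antideriv_coeff' j s * (1 - s - of_nat j) - antideriv_coeff j s"

lemma antideriv_coeff_1 [simp]: "s \<noteq> 1 \<Longrightarrow> antideriv_coeff 1 s = 1"
  by simp

lemma antideriv_coeff'_1: "s \<noteq> 1 \<Longrightarrow> antideriv_coeff' 1 s = 0"
  by (simp add: power2_eq_square mult.assoc)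

lemma antideriv_coeff_of_real: "antideriv_coeff j (of_real x) = (of_real (antideriv_coeff j x) :: complex)"
  by (induction j) simp_all

lemma antideriv_coeff'_of_real: "antideriv_coeff' j (of_real x) = (of_real (antideriv_coeff' j x) :: complex)"
  by (induction j) (simp_all add: antideriv_coeff_of_real)

lemma antideriv_coeff_has_field_derivative:
  fixes s :: "'a :: real_normed_field"
  assumes "s \<noteq> 1"
  shows "(antideriv_coeff j has_field_derivative antideriv_coeff' j s) (at s)"
proof (induction j)
  case 0
  show ?case using assms
    by (auto simp: power2_eq_square intro!: derivative_eq_intros)
next
  case (Suc j)
  show ?case by (auto intro!: derivative_eq_intros Suc)
qed

section \<open>Partial sums with boundary terms as functions of the exponent\<close>

lemma has_field_derivative_powr_exponent:
  fixes w :: complex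
  assumes "w \<noteq> 0" "(f has_field_derivative D) (at s within S)"
  shows "((\<lambda>s. w powr f s) has_field_derivative Ln w * w powr f s * D) (at s within S)"
  using DERIV_chain2[OF has_field_derivative_powr_right[OF assms(1)] assms(2)] .

definition dirichlet_chain :: "nat \<Rightarrow> complex \<Rightarrow> real \<Rightarrow> complex" where
  "dirichlet_chain j s x = antideriv_coeff j s * of_real x powr (1 - s - of_nat j)"

text \<open>The prime denotes the derivative in s, not in x; the power contributes the factor -ln
  x.\<close>

definition dirichlet_chain' :: "nat \<Rightarrow> complex \<Rightarrow> real \<Rightarrow> complex" where
  "dirichlet_chain' j s x = (antideriv_coeff' j s - antideriv_coeff j s * of_real (ln x)) * of_real x powr (1 - s - of_nat j)"

lemma dirichlet_chain_has_field_derivative: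
  assumes "s \<noteq> 1" "x > 0"
  shows "((\<lambda>s. dirichlet_chain j s x) has_field_derivative dirichlet_chain' j s x) (at s)"
  unfolding dirichlet_chain_def dirichlet_chain'_def using assms
  by (auto intro!: derivative_eq_intros has_field_derivative_powr_exponent antideriv_coeff_has_field_derivative
           simp: Ln_of_real algebra_simps)

lemma dirichlet_chain_has_vector_derivative:
  assumes "x > 0"
  shows "(dirichlet_chain j s has_vector_derivative dirichlet_chain (Suc j) s x) (at x within S)"
proof -
  have "((\<lambda>z. antideriv_coeff j s * z powr (1 - s - of_nat j)) has_field_derivative dirichlet_chain (Suc j) s x) (at (of_real x))"
    unfolding dirichlet_chain_def using assms
    by (auto intro!: derivative_eq_intros simp: algebra_simps)
  then show ?thesis
    using has_vector_derivative_real_field has_field_derivative_at_within 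
    unfolding dirichlet_chain_def[abs_def] by blast
qed

lemma norm_dirichlet_chain:
  assumes "x > 0"
  shows "norm (dirichlet_chain j s x) = norm (antideriv_coeff j s) * x powr (1 - Re s - real j)"
  using assms by (simp add: dirichlet_chain_def norm_mult norm_powr_real_powr)

text \<open>The sum starts at index 0 with an antiderivative, so the integral is the term for j = 0.\<close>

definition zeta_approx :: "nat \<Rightarrow> nat \<Rightarrow> complex \<Rightarrow> complex" where
  "zeta_approx q M s = (\<Sum>n=1..M. of_nat n powr (- s)) - (\<Sum>j\<le>q. em_coeff j *\<^sub>R dirichlet_chain j s (real M + 1/2))"

definition zeta_approx' :: "nat \<Rightarrow> nat \<Rightarrow> complex \<Rightarrow> complex" where
  "zeta_approx' q M s = (\<Sum>n=1..M. - of_real (ln (real n)) * of_nat n powr (- s))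
     - (\<Sum>j\<le>q. em_coeff j *\<^sub>R dirichlet_chain' j s (real M + 1/2))"

lemma zeta_approx_has_field_derivative:
  assumes "s \<noteq> 1"
  shows "(zeta_approx q M has_field_derivative zeta_approx' q M s) (at s)"
proof -
  have n: "((\<lambda>s. of_nat n powr (- s)) has_field_derivative (- of_real (ln (real n)) * of_nat n powr (- s))) (at s)"
    if "n \<in> {1..M}" for n
  proof -
    have "((\<lambda>s. of_nat n powr (- s)) has_field_derivative Ln (of_nat n) * of_nat n powr (- s) * (- 1)) (at s)"
      using that by (intro has_field_derivative_powr_exponent) (auto intro!: derivative_eq_intros)
    moreover have "Ln (of_nat n) = of_real (ln (real n))"
      using that by (simp add: Ln_of_nat)
    ultimately show ?thesis by simp
  qed
  show ?thesis
    unfolding zeta_approx_def[abs_def] zeta_approx'_def scaleR_conv_of_real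
    by (intro DERIV_diff DERIV_sum n DERIV_cmult dirichlet_chain_has_field_derivative assms) auto
qed

text \<open>The increment is the error of a single cell of length 1 around n + 1, where the
  derivative of order q + 1 has size x^(- Re s - q). The parameter t allows one exponent for a whole
  disc of values s.\<close>

lemma zeta_approx_Suc_diff:
  assumes "q \<ge> 1" "n \<ge> 1" "s \<noteq> 1" and t: "0 \<le> t" "t \<le> Re s + real q"
  shows "norm (zeta_approx q (Suc n) s - zeta_approx q n s)
           \<le> em_const q * norm (antideriv_coeff (Suc q) s) * real n powr (- t)"
proof -
  have "norm (1 *\<^sub>R dirichlet_chain 1 s (real (Suc n)) - (\<Sum>j\<le>q. (em_coeff j * 1 ^ j) *\<^sub>R
               (dirichlet_chain j s (real (Suc n) + 1/2) - dirichlet_chain j s (real (Suc n) - 1/2))))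
         \<le> em_const q * (1 ^ Suc q * (norm (antideriv_coeff (Suc q) s) * real n powr (- t)))"
  proof (rule em_cell[OF _ _ _ \<open>q \<ge> 1\<close>])
    fix x assume x: "x \<in> {real (Suc n) - 1/2..real (Suc n) + 1/2}"
    then have xn: "x \<ge> real n" and n1: "real n \<ge> 1" using \<open>n \<ge> 1\<close> by auto
    have "x powr (1 - Re s - real (Suc q)) \<le> x powr (- t)"
      using xn n1 t by (intro powr_mono) auto
    also have "\<dots> \<le> real n powr (- t)"
      using xn n1 t by (intro powr_mono2') auto
    finally show "norm (dirichlet_chain (Suc q) s x) \<le> norm (antideriv_coeff (Suc q) s) * real n powr (- t)"
      using xn n1 by (subst norm_dirichlet_chain) (auto intro!: mult_left_mono)
  next
    fix j x assume "x \<in> {real (Suc n) - 1/2..real (Suc n) + 1/2}"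
    then show "(dirichlet_chain j s has_vector_derivative dirichlet_chain (Suc j) s x)
        (at x within {real (Suc n) - 1/2..real (Suc n) + 1/2})"
      by (intro dirichlet_chain_has_vector_derivative) auto
  qed auto
  moreover have "dirichlet_chain 1 s (real (Suc n)) = of_nat (Suc n) powr (- s)"
    using antideriv_coeff_1[OF \<open>s \<noteq> 1\<close>] by (simp add: dirichlet_chain_def del: antideriv_coeff.simps)
  moreover have "real (Suc n) - 1/2 = real n + 1/2" by simp
  ultimately show ?thesis
    by (simp add: zeta_approx_def algebra_simps sum_subtractf del: of_nat_Suc)
qed

text \<open>The order only has to exceed 1 - Re s. Letting it depend on s gives a single formula for
  all s other than 1.\<close>

definition zeta_cont :: "complex \<Rightarrow> complex" where
  "zeta_cont s = lim (\<lambda>M. zeta_approx (nat \<lceil>2 - Re s\<rceil> + 1) M s)"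

text \<open>Weierstrass test for the telescoping series of increments. Uniformity on a disc, rather
  than convergence at s, is what later permits differentiation of the limit.\<close>

lemma zeta_approx_uniform:
  assumes "q \<ge> 1" "s \<noteq> 1" "Re s > 1 - real q"
  obtains d l where "d > 0" "cball s d \<subseteq> {z. Re z > 1 - real q} - {1}"
    "uniform_limit (cball s d) (zeta_approx q) l sequentially"
proof -
  have "0 < min (dist s 1) (Re s - (1 - real q))" using assms by auto
  then obtain d where "d > 0" "d < min (dist s 1) (Re s - (1 - real q))"
    using dense by blast
  then have d: "d > 0" "d < dist s 1" "d < Re s - (1 - real q)"
    by (simp_all only: min_less_iff_conj)
  \<comment> \<open>The least value of Re z + q on the disc; the choice of d makes it exceed 1, so
    that n^(-t) is summable.\<close>
  define t where "t = Re s - d + real q"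
  have t: "t \<le> Re z + real q" if "z \<in> cball s d" for z
  proof -
    have "\<bar>Re s - Re z\<bar> \<le> d"
      using that abs_Re_le_cmod[of "s - z"] by (simp add: dist_norm)
    then show "t \<le> Re z + real q" unfolding t_def by linarith
  qed
  have t1: "t > 1" using d unfolding t_def by linarith
  have ne: "z \<noteq> 1" if "z \<in> cball s d" for z
    using d that by auto
  have "continuous_on (cball s d) (antideriv_coeff (Suc q))"
    by (intro continuous_at_imp_continuous_on ballI DERIV_isCont[OF antideriv_coeff_has_field_derivative] ne)
  then have "bounded (antideriv_coeff (Suc q) ` cball s d)"
    by (rule compact_imp_bounded[OF compact_continuous_image]) simp
  then obtain C where "\<forall>w \<in> antideriv_coeff (Suc q) ` cball s d. norm w \<le> C"
    unfolding bounded_iff by (rule exE)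
  then have C: "norm (antideriv_coeff (Suc q) z) \<le> C" if "z \<in> cball s d" for z
    using that by (simp only: ball_simps)
  have tele: "(\<Sum>i<n. zeta_approx q (Suc i) z - zeta_approx q i z) = zeta_approx q n z - zeta_approx q 0 z" for n z
    by (rule sum_lessThan_telescope)
  have "uniform_limit (cball s d) (\<lambda>n z. \<Sum>i<n. zeta_approx q (Suc i) z - zeta_approx q i z)
     (\<lambda>z. \<Sum>i. zeta_approx q (Suc i) z - zeta_approx q i z) sequentially"
  proof (rule Weierstrass_m_test_ev)
    show "summable (\<lambda>n. em_const q * C * real n powr (- t))"
      using t1 by (intro summable_mult) (simp add: summable_real_powr_iff)
    show "\<forall>\<^sub>F n in sequentially. \<forall>z\<in>cball s d.
        norm (zeta_approx q (Suc n) z - zeta_approx q n z) \<le> em_const q * C * real n powr (- t)"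
    proof (rule eventually_mono[OF eventually_ge_at_top[of 1]], rule ballI)
      fix n z assume n: "1 \<le> (n::nat)" and z: "z \<in> cball s d"
      have "norm (zeta_approx q (Suc n) z - zeta_approx q n z)
          \<le> em_const q * norm (antideriv_coeff (Suc q) z) * real n powr (- t)"
        using t1 t[OF z] by (intro zeta_approx_Suc_diff assms n ne z) auto
      also have "\<dots> \<le> em_const q * C * real n powr (- t)"
        by (intro mult_right_mono mult_left_mono C z em_const_nonneg) auto
      finally show "norm (zeta_approx q (Suc n) z - zeta_approx q n z) \<le> em_const q * C * real n powr (- t)" .
    qed
  qed
  then have "uniform_limit (cball s d) (\<lambda>n z. zeta_approx q 0 z + (\<Sum>i<n. zeta_approx q (Suc i) z - zeta_approx q i z))
     (\<lambda>z. zeta_approx q 0 z + (\<Sum>i. zeta_approx q (Suc i) z - zeta_approx q i z)) sequentially"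
    by (rule uniform_limit_add[OF uniform_limit_const])
  then have "uniform_limit (cball s d) (zeta_approx q)
     (\<lambda>z. zeta_approx q 0 z + (\<Sum>i. zeta_approx q (Suc i) z - zeta_approx q i z)) sequentially"
    by (simp only: tele add_diff_cancel_left' add_diff_eq)
  moreover have "cball s d \<subseteq> {z. Re z > 1 - real q} - {1}"
  proof
    fix z assume "z \<in> cball s d"
    from t[OF this] ne[OF this] t1 show "z \<in> {z. Re z > 1 - real q} - {1}" by simp
  qed
  ultimately show ?thesis using that d(1) by blast
qed

lemma dirichlet_chain_tendsto_0:
  assumes "1 - Re s < real j"
  shows "(\<lambda>M. dirichlet_chain j s (real M + 1/2)) \<longlonglongrightarrow> 0"
proof -
  have "filterlim (\<lambda>M. real M + 1/2) at_top sequentially"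
    by (rule filterlim_at_top_mono[OF filterlim_real_sequentially]) auto
  then have "(\<lambda>M. norm (antideriv_coeff j s) * (real M + 1/2) powr (1 - Re s - real j)) \<longlonglongrightarrow> norm (antideriv_coeff j s) * 0"
    using assms by (intro tendsto_mult tendsto_const tendsto_neg_powr) auto
  then show ?thesis
    by (subst tendsto_norm_zero_iff[symmetric]) (simp add: norm_dirichlet_chain)
qed

text \<open>Raising q subtracts terms that tend to 0, so the limit does not depend on q.\<close>

lemma zeta_approx_tendsto:
  assumes "q \<ge> 1" "s \<noteq> 1" "Re s > 1 - real q"
  shows "(\<lambda>M. zeta_approx q M s) \<longlonglongrightarrow> zeta_cont s"
proof -
  have ex: "\<exists>l. (\<lambda>M. zeta_approx q M s) \<longlonglongrightarrow> l" if q: "q \<ge> 1" "Re s > 1 - real q" for q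
  proof -
    obtain d l where "d > 0" "uniform_limit (cball s d) (zeta_approx q) l sequentially"
      using zeta_approx_uniform[OF q(1) assms(2) q(2)] by blast
    then have "(\<lambda>M. zeta_approx q M s) \<longlonglongrightarrow> l s"
      by (intro tendsto_uniform_limitI) auto
    then show ?thesis by blast
  qed
  have indep: "(\<lambda>M. zeta_approx q' M s) \<longlonglongrightarrow> l"
    if "q \<le> q'" "1 - real q < Re s" "(\<lambda>M. zeta_approx q M s) \<longlonglongrightarrow> l" for q q' l
    using that
  proof (induction q' rule: dec_induct)
    case (step q')
    have "(\<lambda>M. zeta_approx q' M s - em_coeff (Suc q') *\<^sub>R dirichlet_chain (Suc q') s (real M + 1/2)) \<longlonglongrightarrow> l - em_coeff (Suc q') *\<^sub>R 0"
      by (intro tendsto_diff tendsto_scaleR tendsto_const dirichlet_chain_tendsto_0) (use step in auto)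
    then show ?case by (simp add: zeta_approx_def algebra_simps)
  qed
  define q' where "q' = nat \<lceil>2 - Re s\<rceil> + 1"
  have q': "q' \<ge> 1" "Re s > 1 - real q'"
    unfolding q'_def by (simp, linarith)
  obtain l l' where l: "(\<lambda>M. zeta_approx q M s) \<longlonglongrightarrow> l" and l': "(\<lambda>M. zeta_approx q' M s) \<longlonglongrightarrow> l'"
    using ex assms q' by blast
  have "l = l'"
    using indep[of q q' l] indep[of q' q l'] l l' assms q' by (metis LIMSEQ_unique nle_le)
  moreover have "zeta_cont s = l'"
    unfolding zeta_cont_def q'_def[symmetric] using l' by (rule limI)
  ultimately show ?thesis using l by simp
qed

text \<open>A locally uniform limit of holomorphic functions may be differentiated inside the limit.
  The second claim is the source of the values zeta'(-2k).\<close>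

lemma zeta_cont_derivative:
  assumes "q \<ge> 1" "s \<noteq> 1" "Re s > 1 - real q"
  shows "(zeta_cont has_field_derivative deriv zeta_cont s) (at s)"
    and "(\<lambda>M. zeta_approx' q M s) \<longlonglongrightarrow> deriv zeta_cont s"
proof -
  let ?S = "{z. Re z > 1 - real q} - {1}"
  have "\<exists>g'. \<forall>x\<in>?S. (zeta_cont has_field_derivative g' x) (at x) \<and> (\<lambda>M. zeta_approx' q M x) \<longlonglongrightarrow> g' x"
  proof (rule has_complex_derivative_uniform_sequence)
    show "open ?S" by (intro open_Diff open_halfspace_Re_gt) auto
    show "(zeta_approx q n has_field_derivative zeta_approx' q n x) (at x)" if "x \<in> ?S" for n x
      using that by (intro zeta_approx_has_field_derivative) auto
    fix x assume x: "x \<in> ?S"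
    then obtain d l where d: "d > 0" "cball x d \<subseteq> ?S" and u: "uniform_limit (cball x d) (zeta_approx q) l sequentially"
      using zeta_approx_uniform[OF assms(1), of x] by auto
    have "uniform_limit (cball x d) (zeta_approx q) zeta_cont sequentially \<longleftrightarrow>
          uniform_limit (cball x d) (zeta_approx q) l sequentially"
    proof (rule uniform_limit_cong)
      fix z assume z: "z \<in> cball x d"
      have "(\<lambda>M. zeta_approx q M z) \<longlonglongrightarrow> l z"
        using u z by (rule tendsto_uniform_limitI)
      moreover have "(\<lambda>M. zeta_approx q M z) \<longlonglongrightarrow> zeta_cont z"
        using d z assms(1) by (intro zeta_approx_tendsto) auto
      ultimately show "zeta_cont z = l z" by (rule LIMSEQ_unique[symmetric])
    qed auto
    with d u show "\<exists>d>0. cball x d \<subseteq> ?S \<and> uniform_limit (cball x d) (zeta_approx q) zeta_cont sequentially"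
      by blast
  qed
  then show "(zeta_cont has_field_derivative deriv zeta_cont s) (at s)" "(\<lambda>M. zeta_approx' q M s) \<longlonglongrightarrow> deriv zeta_cont s"
    using assms DERIV_imp_deriv by fastforce+
qed

section \<open>Holomorphy and uniqueness of the continuation\<close>

lemma zeta_cont_holomorphic: "zeta_cont holomorphic_on - {1}"
proof -
  have "\<exists>D. (zeta_cont has_field_derivative D) (at s within - {1})" if "s \<in> - {1}" for s
  proof -
    have "Re s > 1 - real (nat \<lceil>1 - Re s\<rceil> + 1)" by linarith
    from zeta_cont_derivative(1)[OF _ _ this] that show ?thesis
      by (auto intro: has_field_derivative_at_within)
  qed
  then show ?thesis by (auto simp: holomorphic_on_def field_differentiable_def)
qed

text \<open>For Re s > 1 every boundary term tends to 0, including the antiderivative of index 0,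
  and the Dirichlet series remains.\<close>

lemma zeta_cont_sums:
  assumes "Re s > 1"
  shows "(\<lambda>n. of_nat (Suc n) powr (- s)) sums zeta_cont s"
proof -
  have s1: "s \<noteq> 1" using assms by auto
  have "(\<lambda>M. zeta_approx 1 M s + (\<Sum>j\<le>1. em_coeff j *\<^sub>R dirichlet_chain j s (real M + 1/2))) \<longlonglongrightarrow>
      zeta_cont s + (\<Sum>j\<le>1. em_coeff j *\<^sub>R 0)"
    using assms s1 by (intro tendsto_add zeta_approx_tendsto tendsto_sum tendsto_scaleR tendsto_const dirichlet_chain_tendsto_0) auto
  then have "(\<lambda>M. \<Sum>n=1..M. of_nat n powr (- s)) \<longlonglongrightarrow> zeta_cont s"
    by (simp add: zeta_approx_def del: sum.atMost_Suc)
  moreover have "(\<Sum>n=1..M. of_nat n powr (- s)) = (\<Sum>n<M. of_nat (Suc n) powr (- s))" for M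
    by (rule sum.reindex_bij_witness[of _ Suc "\<lambda>n. n - 1"]) auto
  ultimately show ?thesis by (simp add: sums_def)
qed

text \<open>\<open>zeta_cont\<close> is the witness that gives the choice in
  \<open>riemann_zeta\<close> its properties. The identity theorem then forces both functions to
  agree, since the punctured plane is connected.\<close>

lemma riemann_zeta_eq_zeta_cont:
  assumes "s \<noteq> 1"
  shows "riemann_zeta s = zeta_cont s"
proof -
  have "riemann_zeta holomorphic_on (- {1}) \<and>
     (\<forall>s. Re s > 1 \<longrightarrow> (\<lambda>n. of_nat (Suc n) powr (- s)) sums riemann_zeta s)"
    unfolding riemann_zeta_def
    by (rule someI[of _ zeta_cont]) (use zeta_cont_holomorphic zeta_cont_sums in blast)
  then have hol: "riemann_zeta holomorphic_on (- {1})"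
    and sums: "\<And>s. Re s > 1 \<Longrightarrow> (\<lambda>n. of_nat (Suc n) powr (- s)) sums riemann_zeta s" by auto
  show ?thesis
  proof (rule analytic_continuation_open[where f = riemann_zeta and g = zeta_cont and s = "{s. Re s > 1}" and s' = "- {1}"])
    show "connected (- {1::complex})"
      by (intro connected_punctured_universe) simp
    have "2 \<in> {s. Re s > 1}" by simp
    then show "{s. Re s > 1} \<noteq> {}" by blast
    show "riemann_zeta z = zeta_cont z" if "z \<in> {s. Re s > 1}" for z
      using that sums zeta_cont_sums sums_unique2 by blast
  qed (use assms hol zeta_cont_holomorphic open_halfspace_Re_gt in auto)
qed

lemma deriv_riemann_zeta: 
  assumes "s \<noteq> 1"
  shows "deriv riemann_zeta s = deriv zeta_cont s"
proof (rule deriv_cong_ev)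
  have "eventually (\<lambda>z. z \<in> - {1}) (nhds s)"
    using assms by (intro eventually_nhds_in_open) auto
  then show "eventually (\<lambda>z. riemann_zeta z = zeta_cont z) (nhds s)"
    by eventually_elim (simp add: riemann_zeta_eq_zeta_cont)
qed simp

section \<open>Regularised power sums\<close>

text \<open>The negated s-derivative of \<open>dirichlet_chain\<close> at s = - 2 k; its member of index 1 is $x^{2k} \ln x$.\<close>

definition log_chain :: "nat \<Rightarrow> nat \<Rightarrow> real \<Rightarrow> real" where
  "log_chain k j x = (antideriv_coeff j (- real (2*k)) * ln x - antideriv_coeff' j (- real (2*k))) * x powr (2 * real k + 1 - real j)"

text \<open>The truncated subtraction is harmless: the coefficient vanishes for j > 2 k + 1.\<close>

definition pow_chain :: "nat \<Rightarrow> nat \<Rightarrow> real \<Rightarrow> real" where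
  "pow_chain k j x = antideriv_coeff j (- real (2*k)) * x ^ (2*k + 1 - j)"

text \<open>At s = -2k the factor 1 - s - (2k+1) is 0: the derivatives of x^(2k+1) vanish from order
  2k+2 on.\<close>

lemma antideriv_coeff_eq_0:
  assumes "j \<ge> 2 * k + 2"
  shows "antideriv_coeff j (- real (2*k)) = 0"
  using assms by (induction j rule: dec_induct) auto

lemma log_chain_deriv:
  assumes "x > 0"
  shows "(log_chain k j has_real_derivative log_chain k (Suc j) x) (at x within S)"
proof -
  let ?e = "2 * real k + 1 - real j" and ?P = "antideriv_coeff j (- real (2*k))" and ?Q = "antideriv_coeff' j (- real (2*k))"
  have "(log_chain k j has_real_derivative
      (?P / x) * x powr ?e + (?P * ln x - ?Q) * (?e * x powr (?e - 1))) (at x within S)"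
    unfolding log_chain_def[abs_def] using assms
    by (auto intro!: derivative_eq_intros simp: divide_simps)
  moreover have "x powr ?e = x * x powr (?e - 1)"
    using assms by (subst powr_mult_base) (auto simp: algebra_simps)
  ultimately show ?thesis
    using assms by (simp add: log_chain_def algebra_simps)
qed

text \<open>\<open>0 powr y\<close> is 0 for every y. For j = 0 this is also the limit at 0, so the
  antiderivative starts from 0.\<close>

lemma log_chain_at_0: "log_chain k j 0 = 0"
  by (simp add: log_chain_def)

lemma log_chain_1: 
  assumes "x > 0" shows "log_chain k 1 x = x ^ (2*k) * ln x"
proof -
  have "x powr (2 * real k) = x ^ (2*k)"
    using assms powr_realpow[of x "2*k"] by simp
  then show ?thesis
    using antideriv_coeff_1[of "- real (2*k)"] antideriv_coeff'_1[of "- real (2*k)"]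
    by (simp add: log_chain_def del: antideriv_coeff.simps antideriv_coeff'.simps)
qed

lemma pow_chain_deriv: "(pow_chain k j has_real_derivative pow_chain k (Suc j) x) (at x within S)"
proof (cases "j \<le> 2*k+1")
  case True
  have "(pow_chain k j has_real_derivative antideriv_coeff j (- real (2*k)) * (real (2*k+1-j) * x ^ (2*k+1-j-1))) (at x within S)"
    unfolding pow_chain_def[abs_def] by (auto intro!: derivative_eq_intros)
  moreover have "real (2*k+1-j) = 2 * real k + 1 - real j" using True by simp
  ultimately show ?thesis by (simp add: pow_chain_def algebra_simps)
next
  case False
  then show ?thesis
    using antideriv_coeff_eq_0[of k j] by (simp add: pow_chain_def[abs_def])
qed

lemma pow_chain_1: "pow_chain k 1 x = x ^ (2*k)"
  using antideriv_coeff_1[of "- real (2*k)"] by (simp add: pow_chain_def del: antideriv_coeff.simps)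

lemma pow_chain_powr:
  assumes "x > 0"
  shows "pow_chain k j x = antideriv_coeff j (- real (2*k)) * x powr (2 * real k + 1 - real j)"
proof (cases "j \<le> 2*k+1")
  case True
  then have "real (2*k+1-j) = 2 * real k + 1 - real j" by simp
  then show ?thesis using assms powr_realpow[of x "2*k+1-j"] by (simp add: pow_chain_def)
next
  case False
  then show ?thesis
    using antideriv_coeff_eq_0[of k j] by (simp add: pow_chain_def[abs_def])
qed

text \<open>The logarithm of h * x splits into ln x + ln h, and the second summand multiplies the
  chain of the pure power. This is the origin of the term h ln h in the rule.\<close>

lemma log_chain_scale:
  assumes "x > 0" "h > 0"
  shows "h ^ j * log_chain k j (h * x) = h ^ (2*k+1) * (log_chain k j x + ln h * pow_chain k j x)"
proof -
  have "h ^ j * h powr (2 * real k + 1 - real j) = h ^ (2*k+1)"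
  proof -
    have "h powr real j * h powr (2 * real k + 1 - real j) = h powr real (2*k+1)"
      by (simp add: powr_add[symmetric] add.commute)
    then show ?thesis using assms by (simp only: powr_realpow)
  qed
  moreover have "h ^ j * log_chain k j (h * x) = (h ^ j * h powr (2 * real k + 1 - real j))
      * ((antideriv_coeff j (- real (2*k)) * (ln x + ln h) - antideriv_coeff' j (- real (2*k))) * x powr (2 * real k + 1 - real j))"
    using assms by (simp add: log_chain_def powr_mult ln_mult add.commute)
  ultimately have "h ^ j * log_chain k j (h * x) = h ^ (2*k+1)
      * ((antideriv_coeff j (- real (2*k)) * (ln x + ln h) - antideriv_coeff' j (- real (2*k))) * x powr (2 * real k + 1 - real j))"
    by simp
  then show ?thesis
    using assms by (simp add: log_chain_def pow_chain_powr algebra_simps)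
qed

text \<open>The formula has no error for x^(2k), so only the boundary terms at 1/2 survive. Their
  value comes from the cell around 0, whose two ends contribute equally by parity: twice that value
  is 0^(2k). The results are zeta(0) = -1/2 and the trivial zeros of zeta.\<close>

lemma em_pow_exact:
  assumes q: "q \<ge> 2*k+1"
  shows "(\<Sum>n=1..M. real n ^ (2*k)) - (\<Sum>j\<le>q. em_coeff j * pow_chain k j (real M + 1/2))
           = (if k = 0 then -1/2 else 0)"
proof -
  have cell: "c ^ (2*k) = (\<Sum>j\<le>q. em_coeff j * (pow_chain k j (c + 1/2) - pow_chain k j (c - 1/2)))" for c :: real
  proof -
    have "norm (1 *\<^sub>R pow_chain k 1 c - (\<Sum>j\<le>q. (em_coeff j * 1 ^ j) *\<^sub>R
        (pow_chain k j (c + 1/2) - pow_chain k j (c - 1/2)))) \<le> em_const q * (1 ^ Suc q * 0)"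
    proof (rule em_cell)
      fix j x assume "x \<in> {c - 1/2..c + 1/2}"
      show "(pow_chain k j has_vector_derivative pow_chain k (Suc j) x) (at x within {c - 1/2..c + 1/2})"
        using pow_chain_deriv by (simp add: has_real_derivative_iff_has_vector_derivative)
    next
      fix x :: real
      show "norm (pow_chain k (Suc q) x) \<le> 0"
        using antideriv_coeff_eq_0[of k "Suc q"] q by (simp add: pow_chain_def del: antideriv_coeff.simps)
    qed (use q in auto)
    then show ?thesis by (simp add: pow_chain_1[unfolded One_nat_def])
  qed
  have symm: "em_coeff j * pow_chain k j (- 1/2) = - (em_coeff j * pow_chain k j (1/2))" for j
  proof (cases "even j \<and> j \<le> 2*k+1")
    case True
    then have "odd (2*k+1-j)" by simp
    then show ?thesis by (simp add: pow_chain_def)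
  next
    case False
    then show ?thesis using em_coeff_odd[of j] antideriv_coeff_eq_0[of k j] by (auto simp: pow_chain_def not_le)
  qed
  have "0 ^ (2*k) = (\<Sum>j\<le>q. 2 * (em_coeff j * pow_chain k j (1/2)))"
    using cell[of 0] symm by (simp add: right_diff_distrib)
  then have base: "(\<Sum>j\<le>q. em_coeff j * pow_chain k j (1/2)) = (if k = 0 then 1/2 else 0)"
    by (cases "k = 0") (simp_all add: power_0_left flip: sum_distrib_left)
  show ?thesis
  proof (induction M)
    case 0
    then show ?case using base by simp
  next
    case (Suc M)
    have "real (Suc M) - 1/2 = real M + 1/2" by simp
    then show ?case
      using Suc cell[of "real (Suc M)"] unfolding \<open>real (Suc M) - 1/2 = real M + 1/2\<close> by (simp add: right_diff_distrib sum_subtractf del: of_nat_Suc)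
  qed
qed

definition em_log :: "nat \<Rightarrow> nat \<Rightarrow> nat \<Rightarrow> real" where
  "em_log q k M = (\<Sum>n=1..M. real n ^ (2*k) * ln (real n)) - (\<Sum>j\<le>q. em_coeff j * log_chain k j (real M + 1/2))"

lemma zeta_approx'_em_log: "zeta_approx' q M (- of_nat (2*k)) = - of_real (em_log q k M)"
proof -
  have e: "of_real x powr (1 - (- of_nat (2*k)) - of_nat j) = complex_of_real (x powr (2 * real k + 1 - real j))" if "x > 0" for x j
  proof -
    have "1 - (- of_nat (2*k)) - of_nat j = complex_of_real (2 * real k + 1 - real j)" by simp
    then show ?thesis using that powr_of_real[of x] by (metis less_imp_le)
  qed
  have P: "antideriv_coeff j (- of_nat (2*k)) = complex_of_real (antideriv_coeff j (- real (2*k)))" for j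
    using antideriv_coeff_of_real[of j "- real (2*k)"] by simp
  have Q: "antideriv_coeff' j (- of_nat (2*k)) = complex_of_real (antideriv_coeff' j (- real (2*k)))" for j
    using antideriv_coeff'_of_real[of j "- real (2*k)"] by simp
  have G: "dirichlet_chain' j (- of_nat (2*k)) x = - of_real (log_chain k j x)" if "x > 0" for j x
    unfolding dirichlet_chain'_def e[OF that] P Q log_chain_def by (simp add: algebra_simps)
  have n: "of_nat n powr (- (- of_nat (2*k))) = complex_of_real (real n ^ (2*k))" if "n \<in> {1..M}" for n
  proof -
    have "of_nat n powr (of_nat (2*k)) = (of_nat n ^ (2*k) :: complex)"
      using that by (subst powr_nat') auto
    then show ?thesis by simp
  qed
  show ?thesis
  proof -
    have "(\<Sum>n=1..M. - of_real (ln (real n)) * of_nat n powr (- (- of_nat (2*k))))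
        = - complex_of_real (\<Sum>n=1..M. real n ^ (2*k) * ln (real n))"
      unfolding of_real_sum sum_negf[symmetric] by (intro sum.cong refl, subst n) auto
    moreover have "(\<Sum>j\<le>q. em_coeff j *\<^sub>R dirichlet_chain' j (- of_nat (2*k)) (real M + 1/2))
        = - complex_of_real (\<Sum>j\<le>q. em_coeff j * log_chain k j (real M + 1/2))"
      unfolding of_real_sum sum_negf[symmetric]
      by (intro sum.cong refl, subst G) (auto simp: scaleR_conv_of_real)
    ultimately show ?thesis
      unfolding zeta_approx'_def em_log_def of_real_diff by simp
  qed
qed

lemma em_log_tendsto:
  assumes "q \<ge> 2*k+2"
  shows "(\<lambda>M. complex_of_real (em_log q k M)) \<longlonglongrightarrow> - deriv riemann_zeta (- of_nat (2*k))"
proof -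
  have ne: "- of_nat (2*k) \<noteq> (1::complex)"
    by (simp add: complex_eq_iff)
  have "(\<lambda>M. - zeta_approx' q M (- of_nat (2*k))) \<longlonglongrightarrow> - deriv zeta_cont (- of_nat (2*k))"
    using assms ne by (intro tendsto_minus zeta_cont_derivative(2)) auto
  then show ?thesis
    by (simp add: zeta_approx'_em_log deriv_riemann_zeta[OF ne] del: of_nat_mult)
qed

text \<open>The tail is compared with a telescoping sum: 1/n^2 is at most 2 (1/n - 1/(n+1)), because
  n + 1 <= 2 n. The other r powers of 1/n are bounded by their value at M.\<close>

lemma tendsto_rate:
  fixes v :: "nat \<Rightarrow> real"
  assumes diff: "\<And>n. n \<ge> 1 \<Longrightarrow> \<bar>v (Suc n) - v n\<bar> \<le> C / real n ^ (r + 2)"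
    and lim: "v \<longlonglongrightarrow> l" and M: "M \<ge> 1"
  shows "\<bar>l - v M\<bar> \<le> 2 * C / real M ^ (r + 1)"
proof -
  have C: "C \<ge> 0" using diff[of 1] by simp
  have bound: "\<bar>v (M + i) - v M\<bar> \<le> 2 * C / real M ^ r * (1 / real M - 1 / real (M + i))" for i
  proof (induction i)
    case (Suc i)
    let ?n = "real (M + i)"
    have n: "?n \<ge> 1" using M by simp
    have "\<bar>v (Suc (M + i)) - v (M + i)\<bar> \<le> C / ?n ^ (r + 2)"
      using diff[of "M + i"] M by simp
    also have "\<dots> = C / ?n ^ r * (1 / ?n ^ 2)"
      by (simp only: power_add times_divide_times_eq mult_1_right)
    also have "\<dots> \<le> C / real M ^ r * (2 * (1 / ?n - 1 / (?n + 1)))"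
    proof (intro mult_mono divide_left_mono power_mono)
      have "1 / a ^ 2 \<le> 2 * (1 / a - 1 / (a + 1))" if "a \<ge> 1" for a :: real
      proof -
        have "1 / a ^ 2 = 2 / (2 * a ^ 2)" by simp
        also have "\<dots> \<le> 2 / (a * (a + 1))"
          using that mult_left_mono[of 1 a a]
          by (intro divide_left_mono mult_pos_pos) (auto simp: power2_eq_square algebra_simps)
        also have "\<dots> = 2 * (1 / a - 1 / (a + 1))"
          using that by (simp add: field_simps)
        finally show ?thesis .
      qed
      then show "1 / ?n ^ 2 \<le> 2 * (1 / ?n - 1 / (?n + 1))" using n .
    qed (use n M C in simp_all)
    finally show ?case using Suc by (simp add: algebra_simps)
  qed simp
  have "(\<lambda>i. \<bar>v (M + i) - v M\<bar>) \<longlonglongrightarrow> \<bar>l - v M\<bar>"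
    using LIMSEQ_ignore_initial_segment[OF lim, of M]
    by (intro tendsto_rabs tendsto_diff tendsto_const) (simp add: add.commute)
  then show ?thesis
  proof (rule LIMSEQ_le_const2, intro exI[of _ 0] allI impI)
    fix i
    have "\<bar>v (M + i) - v M\<bar> \<le> 2 * C / real M ^ r * (1 / real M)"
      using C by (intro order_trans[OF bound] mult_left_mono) auto
    then show "\<bar>v (M + i) - v M\<bar> \<le> 2 * C / real M ^ (r + 1)" by (simp add: mult.commute)
  qed
qed

text \<open>Beyond index 2k+1 the coefficient of ln x vanishes, so the derivative in the cell error
  is a pure power x^(-(r+2)) and no logarithm enters the rate. The exponent r + 1 is what h^(2k+1)
  lacks to be h^q.\<close>

lemma em_log_rate:
  assumes q: "q = 2*k + r + 2" and Z: "- deriv riemann_zeta (- of_nat (2*k)) = complex_of_real Z"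
  obtains C where "\<And>M. M \<ge> 1 \<Longrightarrow> \<bar>Z - em_log q k M\<bar> \<le> C / real M ^ (r + 1)"
proof -
  have lim: "em_log q k \<longlonglongrightarrow> Z"
    using em_log_tendsto[of k q] q Z by (simp add: tendsto_of_real_iff)
  define C where "C = em_const q * \<bar>antideriv_coeff' (Suc q) (- real (2*k))\<bar>"
  have "\<bar>em_log q k (Suc n) - em_log q k n\<bar> \<le> C / real n ^ (r + 2)" if n: "n \<ge> 1" for n
  proof -
    have "norm (1 *\<^sub>R log_chain k 1 (real (Suc n)) - (\<Sum>j\<le>q. (em_coeff j * 1 ^ j) *\<^sub>R
               (log_chain k j (real (Suc n) + 1/2) - log_chain k j (real (Suc n) - 1/2))))
         \<le> em_const q * (1 ^ Suc q * (\<bar>antideriv_coeff' (Suc q) (- real (2*k))\<bar> / real n ^ (r + 2)))"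
    proof (rule em_cell)
      fix x assume x: "x \<in> {real (Suc n) - 1/2..real (Suc n) + 1/2}"
      then have xn: "x \<ge> real n" and n1: "real n \<ge> 1" using \<open>n \<ge> 1\<close> by auto
      have "x powr (2 * real k + 1 - real (Suc q)) = x powr (- real (r + 2))"
        by (simp add: q)
      also have "\<dots> = 1 / x powr real (r + 2)"
        by (rule powr_minus_divide)
      also have "\<dots> = 1 / x ^ (r + 2)"
        using xn n1 by (subst powr_realpow) auto
      also have "\<dots> \<le> 1 / real n ^ (r + 2)"
        using xn n1 by (intro divide_left_mono power_mono mult_pos_pos zero_less_power) auto
      finally have "\<bar>antideriv_coeff' (Suc q) (- real (2*k))\<bar> * x powr (2 * real k + 1 - real (Suc q))
          \<le> \<bar>antideriv_coeff' (Suc q) (- real (2*k))\<bar> * (1 / real n ^ (r + 2))"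
        by (rule mult_left_mono) simp
      moreover have "antideriv_coeff (Suc q) (- real (2*k)) = 0"
        using q by (intro antideriv_coeff_eq_0) simp
      ultimately show "norm (log_chain k (Suc q) x) \<le> \<bar>antideriv_coeff' (Suc q) (- real (2*k))\<bar> / real n ^ (r + 2)"
        by (simp add: log_chain_def abs_mult del: antideriv_coeff.simps antideriv_coeff'.simps of_nat_Suc)
    next
      fix j x assume "x \<in> {real (Suc n) - 1/2..real (Suc n) + 1/2}"
      then show "(log_chain k j has_vector_derivative log_chain k (Suc j) x)
          (at x within {real (Suc n) - 1/2..real (Suc n) + 1/2})"
        using log_chain_deriv by (simp add: has_real_derivative_iff_has_vector_derivative)
    qed (use q in auto)
    moreover have "log_chain k 1 (real (Suc n)) = real (Suc n) ^ (2*k) * ln (real (Suc n))"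
      by (rule log_chain_1) simp
    moreover have "real (Suc n) - 1/2 = real n + 1/2" by simp
    ultimately show ?thesis
      by (simp add: em_log_def C_def algebra_simps sum_subtractf del: of_nat_Suc power_Suc)
  qed
  from tendsto_rate[OF this lim] show ?thesis using that by blast
qed

section \<open>Logarithm times a flat function\<close>

definition leibniz :: "(nat \<Rightarrow> real \<Rightarrow> real) \<Rightarrow> (nat \<Rightarrow> real \<Rightarrow> real) \<Rightarrow> nat \<Rightarrow> real \<Rightarrow> real" where
  "leibniz u v j x = (\<Sum>i\<le>j. real (j choose i) * (u i x * v (j - i) x))"

lemma leibniz_0 [simp]: "leibniz u v 0 x = u 0 x * v 0 x"
  by (simp add: leibniz_def)

lemma leibniz_deriv:
  assumes u: "\<And>i. i \<le> j \<Longrightarrow> (u i has_real_derivative u (Suc i) x) (at x within S)"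
    and v: "\<And>i. i \<le> j \<Longrightarrow> (v i has_real_derivative v (Suc i) x) (at x within S)"
  shows "(leibniz u v j has_real_derivative leibniz u v (Suc j) x) (at x within S)"
proof -
  define a where "a i = u i x * v (Suc j - i) x" for i
  have "(leibniz u v j has_real_derivative
      (\<Sum>i\<le>j. real (j choose i) * (u i x * v (Suc (j - i)) x + u (Suc i) x * v (j - i) x))) (at x within S)"
    unfolding leibniz_def[abs_def]
    by (intro DERIV_sum DERIV_cmult DERIV_mult' u v) auto
  also have "(\<Sum>i\<le>j. real (j choose i) * (u i x * v (Suc (j - i)) x + u (Suc i) x * v (j - i) x))
      = (\<Sum>i\<le>j. real (j choose i) * a i) + (\<Sum>i\<le>j. real (j choose i) * a (Suc i))"
    unfolding sum.distrib[symmetric]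
    by (rule sum.cong[OF refl]) (simp add: a_def algebra_simps Suc_diff_le)
  \<comment> \<open>The added term has coefficient \<open>j choose Suc j\<close>, which is 0; the
    ranges now match for Pascal's rule.\<close>
  also have "(\<Sum>i\<le>j. real (j choose i) * a i) = (\<Sum>i\<le>Suc j. real (j choose i) * a i)"
    by simp
  also have "\<dots> = a 0 + (\<Sum>i\<le>j. real (j choose Suc i) * a (Suc i))"
    by (subst sum.atMost_Suc_shift) simp
  also have "\<dots> + (\<Sum>i\<le>j. real (j choose i) * a (Suc i)) = leibniz u v (Suc j) x"
    unfolding leibniz_def a_def[symmetric]
    by (subst sum.atMost_Suc_shift) (simp add: algebra_simps sum.distrib)
  finally show ?thesis .
qed

primrec ln_chain :: "nat \<Rightarrow> real \<Rightarrow> real" where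
  "ln_chain 0 x = ln x"
| "ln_chain (Suc i) x = (- 1) ^ i * fact i * inverse x ^ Suc i"

lemma ln_chain_deriv:
  assumes "x > 0"
  shows "(ln_chain i has_real_derivative ln_chain (Suc i) x) (at x within S)"
proof (cases i)
  case 0
  have "ln_chain 0 = ln" by (rule ext) simp
  then show ?thesis using 0 DERIV_ln[OF assms] by (auto intro: has_field_derivative_at_within)
next
  case (Suc m)
  have "((\<lambda>x. (- 1) ^ m * fact m * inverse x ^ Suc m) has_real_derivative
      (- 1) ^ m * fact m * ((1 + real m) * (- (inverse x ^ Suc (Suc 0)) * inverse x ^ m))) (at x within S)"
    by (intro DERIV_cmult DERIV_power_Suc DERIV_inverse) (use assms in simp)
  moreover have "ln_chain (Suc m) = (\<lambda>x. (- 1) ^ m * fact m * inverse x ^ Suc m)"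
    by (rule ext) simp
  ultimately show ?thesis by (simp add: Suc algebra_simps)
qed

text \<open>The inequality ln y <= y - 1 is applied to y = sqrt x and to y = 1 / sqrt x. A power is
  easier to combine with flatness than a logarithm, and 1 / sqrt x is still summable over the cells
  at the required rate.\<close>

lemma abs_ln_le_sqrt:
  fixes x a :: real
  assumes "0 < x" "x \<le> a"
  shows "\<bar>ln x\<bar> \<le> 2 * (1 + a) / sqrt x"
proof -
  have s: "sqrt x > 0" and ln: "ln x = 2 * ln (sqrt x)" using assms by (simp_all add: ln_sqrt)
  have "ln (sqrt x) \<le> a / sqrt x"
  proof -
    have "ln (sqrt x) \<le> sqrt x" using ln_le_minus_one[OF s] by simp
    also have "\<dots> = x / sqrt x" using assms by (simp add: real_div_sqrt)
    also have "\<dots> \<le> a / sqrt x" using assms by (intro divide_right_mono) auto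
    finally show ?thesis .
  qed
  moreover have "- ln (sqrt x) \<le> 1 / sqrt x"
  proof -
    have "ln (1 / sqrt x) \<le> 1 / sqrt x - 1" using s by (intro ln_le_minus_one) simp
    then show ?thesis using s by (simp add: ln_div)
  qed
  moreover have "0 \<le> a / sqrt x" "0 \<le> 1 / sqrt x" using assms by auto
  ultimately have "\<bar>ln (sqrt x)\<bar> \<le> 1 / sqrt x + a / sqrt x" by linarith
  then show ?thesis unfolding ln by (simp add: add_divide_distrib abs_mult distrib_left)
qed

lemma ln_chain_bound:
  fixes a :: real
  obtains C where "C \<ge> 0" "\<And>x. \<lbrakk>0 < x; x \<le> a\<rbrakk> \<Longrightarrow> \<bar>ln_chain i x\<bar> \<le> C * inverse x ^ i / sqrt x"
proof (cases i)
  case 0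
  show ?thesis by (rule that[of "2 * (1 + max 0 a)"]) (use abs_ln_le_sqrt 0 in \<open>auto simp: max_def not_le\<close>)
next
  case (Suc m)
  show ?thesis
  proof (rule that[of "fact m * sqrt (max 0 a)"])
    fix x assume x: "0 < x" "x \<le> a"
    have "1 \<le> sqrt (max 0 a) / sqrt x" using x by simp
    then have "fact m * inverse x ^ i * 1 \<le> fact m * inverse x ^ i * (sqrt (max 0 a) / sqrt x)"
      using x by (intro mult_left_mono) auto
    then show "\<bar>ln_chain i x\<bar> \<le> fact m * sqrt (max 0 a) * inverse x ^ i / sqrt x"
      using x by (simp add: Suc abs_mult power_abs mult_ac)
  qed simp
qed

text \<open>In each Leibniz term, i derivatives of ln cost x^i, while \<open>R (j - i)\<close> is
  flatter than \<open>R j\<close> by x^i, so all terms have the same order. The only net loss from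
  ln is 1 / sqrt x.\<close>

lemma leibniz_ln_bound:
  fixes a B :: real
  assumes R: "\<And>i x. \<lbrakk>i \<le> q; 0 \<le> x; x \<le> a\<rbrakk> \<Longrightarrow> \<bar>R i x\<bar> \<le> B * x ^ (q - i)"
  obtains C where "C \<ge> 0" "\<And>j x. \<lbrakk>j \<le> q; 0 < x; x \<le> a\<rbrakk> \<Longrightarrow> \<bar>leibniz ln_chain R j x\<bar> \<le> C * x ^ (q - j) / sqrt x"
proof -
  have "\<exists>C. C \<ge> 0 \<and> (\<forall>x. 0 < x \<longrightarrow> x \<le> a \<longrightarrow> \<bar>ln_chain i x\<bar> \<le> C * inverse x ^ i / sqrt x)" for i
    by (rule ln_chain_bound[of a i]) blast
  then obtain D where D0: "\<And>i. D i \<ge> 0"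
    and D: "\<And>i x. \<lbrakk>0 < x; x \<le> a\<rbrakk> \<Longrightarrow> \<bar>ln_chain i x\<bar> \<le> D i * inverse x ^ i / sqrt x"
    by metis
  define E where "E j = (\<Sum>i\<le>j. real (j choose i) * (D i * \<bar>B\<bar>))" for j
  define C where "C = (\<Sum>j\<le>q. E j)"
  have E0: "E j \<ge> 0" for j unfolding E_def using D0 by (intro sum_nonneg) auto
  show ?thesis
  proof (rule that)
    show "C \<ge> 0" unfolding C_def using E0 by (intro sum_nonneg) auto
    fix j x assume j: "j \<le> q" and x: "0 < x" "x \<le> a"
    have "\<bar>leibniz ln_chain R j x\<bar> \<le> (\<Sum>i\<le>j. \<bar>real (j choose i) * (ln_chain i x * R (j - i) x)\<bar>)"
      unfolding leibniz_def by (rule sum_abs)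
    also have "\<dots> \<le> (\<Sum>i\<le>j. (real (j choose i) * (D i * \<bar>B\<bar>)) * (x ^ (q - j) / sqrt x))"
    proof (rule sum_mono)
      fix i assume i: "i \<in> {..j}"
      have "\<bar>R (j - i) x\<bar> \<le> \<bar>B\<bar> * x ^ (q - (j - i))"
        using R[of "j - i" x] x j by (auto intro!: order_trans[OF _ mult_right_mono[of B "\<bar>B\<bar>"]])
      also have "q - (j - i) = (q - j) + i" using i j by simp
      finally have "\<bar>ln_chain i x\<bar> * \<bar>R (j - i) x\<bar> \<le> (D i * inverse x ^ i / sqrt x) * (\<bar>B\<bar> * x ^ ((q - j) + i))"
        using D[OF x, of i] D0[of i] x by (intro mult_mono) auto
      also have "\<dots> = (D i * \<bar>B\<bar>) * (x ^ (q - j) / sqrt x)"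
        using x by (simp add: power_add power_inverse field_simps)
      finally show "\<bar>real (j choose i) * (ln_chain i x * R (j - i) x)\<bar>
          \<le> (real (j choose i) * (D i * \<bar>B\<bar>)) * (x ^ (q - j) / sqrt x)"
        unfolding abs_mult abs_of_nat mult.assoc[of "real (j choose i)"] by (intro mult_left_mono) auto
    qed
    also have "\<dots> = E j * (x ^ (q - j) / sqrt x)"
      unfolding E_def by (rule sum_distrib_right[symmetric])
    also have "\<dots> \<le> C * (x ^ (q - j) / sqrt x)"
      unfolding C_def using j x E0 by (intro mult_right_mono member_le_sum) auto
    finally show "\<bar>leibniz ln_chain R j x\<bar> \<le> C * x ^ (q - j) / sqrt x" by simp
  qed
qed

text \<open>The bound forces both f 0 = 0 and the limit 0 there, so continuity needs a separate
  argument only away from the singular point.\<close>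

lemma continuous_on_from_sqrt_bound:
  fixes f :: "real \<Rightarrow> real"
  assumes cont: "\<And>x. \<lbrakk>0 < x; x \<le> a\<rbrakk> \<Longrightarrow> continuous (at x within {0..a}) f"
    and bound: "\<And>x. \<lbrakk>0 \<le> x; x \<le> a\<rbrakk> \<Longrightarrow> \<bar>f x\<bar> \<le> C * sqrt x"
  shows "continuous_on {0..a} f"
proof (unfold continuous_on_eq_continuous_within, rule ballI)
  fix x assume x: "x \<in> {0..a}"
  show "continuous (at x within {0..a}) f"
  proof (cases "x = 0")
    case True
    have "f 0 = 0" using bound[of 0] x by simp
    have "((\<lambda>x. C * sqrt x) \<longlongrightarrow> C * sqrt 0) (at 0 within {0..a})"
      by (intro tendsto_mult tendsto_const tendsto_real_sqrt tendsto_ident_at)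
    then have "((\<lambda>x. C * sqrt x) \<longlongrightarrow> 0) (at 0 within {0..a})" by simp
    then have "(f \<longlongrightarrow> 0) (at 0 within {0..a})"
      by (rule Lim_null_comparison[rotated]) (use bound in \<open>auto simp: eventually_at_filter\<close>)
    then show ?thesis using \<open>f 0 = 0\<close> True by (simp add: continuous_within)
  qed (use cont x in auto)
qed

text \<open>Both sides are chains with the same first member, and derivatives are unique. This lets
  the boundary terms of the monomials combine with those of the remainder into a Leibniz sum for F
  itself.\<close>

lemma ln_chain_leibniz_pow:
  assumes "x > 0"
  shows "leibniz ln_chain (\<lambda>i. pow_chain k (Suc i)) j x = log_chain k (Suc j) x"
  using assms
proof (induction j arbitrary: x)
  case 0
  then show ?case using log_chain_1[of x k] pow_chain_1[of k x] by (simp add: mult.commute)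
next
  case (Suc j)
  let ?L = "leibniz ln_chain (\<lambda>i. pow_chain k (Suc i))"
  have "(?L j has_real_derivative ?L (Suc j) x) (at x)"
    using Suc.prems by (intro leibniz_deriv ln_chain_deriv pow_chain_deriv)
  then have "(log_chain k (Suc j) has_real_derivative ?L (Suc j) x) (at x)"
    by (rule has_field_derivative_transform_within_open[where S = "{0<..}"]) (use Suc in auto)
  then show ?case
    using log_chain_deriv[OF Suc.prems] by (rule DERIV_unique)
qed

section \<open>Even Taylor polynomials and their remainders\<close>

lemma antideriv_coeff_nonzero:
  assumes "j \<le> 2*k + 1"
  shows "antideriv_coeff j (- real (2*k)) \<noteq> 0"
  using assms by (induction j) (auto simp: add_eq_0_iff)

text \<open>The denominator is (2k)!, so this is the Taylor coefficient of x^(2k).\<close>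

definition even_coeff :: "(nat \<Rightarrow> real \<Rightarrow> real) \<Rightarrow> nat \<Rightarrow> real" where
  "even_coeff u k = u (2*k) 0 / antideriv_coeff (2*k+1) (- real (2*k))"

definition even_rem :: "nat \<Rightarrow> (nat \<Rightarrow> real \<Rightarrow> real) \<Rightarrow> nat \<Rightarrow> real \<Rightarrow> real" where
  "even_rem K u j x = u j x - (\<Sum>k\<le>K. even_coeff u k * pow_chain k (Suc j) x)"

lemma pow_chain_at_0: "pow_chain k (Suc j) 0 = (if j = 2*k then antideriv_coeff (2*k+1) (- real (2*k)) else 0)"
  using antideriv_coeff_eq_0[of k "Suc j"] by (auto simp: pow_chain_def power_0_left not_less simp del: antideriv_coeff.simps)

lemma even_rem_deriv:
  assumes "(u j has_real_derivative u (Suc j) x) (at x within S)"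
  shows "(even_rem K u j has_real_derivative even_rem K u (Suc j) x) (at x within S)"
  unfolding even_rem_def[abs_def]
  by (intro DERIV_diff assms DERIV_sum DERIV_cmult pow_chain_deriv)

text \<open>All derivatives of the remainder below order q vanish at 0: the even ones by the choice
  of coefficients, the odd ones by assumption. The polynomial has degree at most 2K < q, so the
  derivative of order q is that of u and bounded by compactness.\<close>

lemma even_rem_bound:
  assumes q: "q = 2*K + 2" and a: "a > 0"
    and der: "\<And>j x. \<lbrakk>j < q; x \<in> {0..a}\<rbrakk> \<Longrightarrow> (u j has_real_derivative u (Suc j) x) (at x within {0..a})"
    and cont: "continuous_on {0..a} (u q)"
    and odd: "\<And>j. \<lbrakk>j < q; odd j\<rbrakk> \<Longrightarrow> u j 0 = 0"
  obtains B where "B \<ge> 0" "\<And>j x. \<lbrakk>j \<le> q; 0 \<le> x; x \<le> a\<rbrakk> \<Longrightarrow> \<bar>even_rem K u j x\<bar> \<le> B * x ^ (q - j)"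
proof -
  have "bounded (u q ` {0..a})"
    by (rule compact_imp_bounded[OF compact_continuous_image[OF cont]]) simp
  then obtain B where "\<forall>w\<in>u q ` {0..a}. norm w \<le> B"
    unfolding bounded_iff by (rule exE)
  then have B: "\<bar>u q x\<bar> \<le> B" if "x \<in> {0..a}" for x
    using that by simp
  have "\<bar>even_rem K u j x\<bar> \<le> B * x ^ (q - j)" if "j \<le> q" "0 \<le> x" "x \<le> a" for j x
  proof -
    have "norm (even_rem K u j x) \<le> B * \<bar>x\<bar> ^ (q - j)"
    proof (rule chain_flat_bound[where S = "{0..a}"])
      fix i x assume "i < q" "x \<in> {0..a}"
      then show "(even_rem K u i has_vector_derivative even_rem K u (Suc i) x) (at x within {0..a})"
        using even_rem_deriv[where u = u and j = i and x = x, OF der] by (simp add: has_real_derivative_iff_has_vector_derivative)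
    next
      fix i assume i: "i < q"
      have "(\<Sum>k\<le>K. even_coeff u k * pow_chain k (Suc i) 0) = u i 0"
      proof (cases "even i")
        case True
        then obtain m where m: "i = 2 * m" by blast
        have "(\<Sum>k\<le>K. even_coeff u k * pow_chain k (Suc i) 0) = (\<Sum>k\<le>K. if k = m then u i 0 else 0)"
          unfolding pow_chain_at_0 m even_coeff_def
          by (rule sum.cong[OF refl]) (use antideriv_coeff_nonzero[of "2*m+1" m] in auto)
        then show ?thesis using i q m by simp
      next
        case False
        then show ?thesis unfolding pow_chain_at_0 using odd[OF i False] by (auto intro!: sum.neutral)
      qed
      then show "even_rem K u i 0 = 0" by (simp add: even_rem_def)
    next
      fix x assume x: "x \<in> {0..a}"
      have "pow_chain k (Suc q) x = 0" if "k \<le> K" for k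
        using that q antideriv_coeff_eq_0[of k "Suc q"] by (simp add: pow_chain_def del: antideriv_coeff.simps)
      then show "norm (even_rem K u q x) \<le> B" using B[OF x] by (simp add: even_rem_def)
    qed (use a that in auto)
    then show ?thesis using that by simp
  qed
  moreover have "B \<ge> 0" using B[of 0] a by simp
  ultimately show ?thesis using that by blast
qed

text \<open>For k = 0 the integrand is unbounded at 0. The fundamental theorem with derivatives in
  the interior only asks for continuity at the end points, which the sqrt bound provides at
  0.\<close>

lemma log_chain_0_integral:
  assumes "a > 0"
  shows "((\<lambda>x. ln x * x ^ (2*k)) has_integral log_chain k 0 a) {0..a}"
proof -
  have "((\<lambda>x. ln x * x ^ (2*k)) has_integral (log_chain k 0 a - log_chain k 0 0)) {0..a}"
  proof (rule fundamental_theorem_of_calculus_interior)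
    fix x assume "x \<in> {0<..<a}"
    then show "(log_chain k 0 has_vector_derivative ln x * x ^ (2*k)) (at x)"
      using log_chain_deriv[of x k 0 UNIV] log_chain_1[of x k]
      by (simp add: has_real_derivative_iff_has_vector_derivative mult.commute)
  next
    let ?P = "antideriv_coeff 0 (- real (2*k))" and ?Q = "antideriv_coeff' 0 (- real (2*k))"
    show "continuous_on {0..a} (log_chain k 0)"
    proof (rule continuous_on_from_sqrt_bound)
      show "continuous (at x within {0..a}) (log_chain k 0)" if "0 < x" for x
        using log_chain_deriv[OF that] by (rule DERIV_continuous)
      fix x assume x: "0 \<le> x" "x \<le> a"
      show "\<bar>log_chain k 0 x\<bar> \<le> ((\<bar>?P\<bar> * (2 * (1 + a)) + \<bar>?Q\<bar> * sqrt a) * a ^ (2*k)) * sqrt x"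
      proof (cases "x = 0")
        case False
        then have x0: "x > 0" using x by simp
        have "\<bar>?P * ln x - ?Q\<bar> \<le> \<bar>?P\<bar> * \<bar>ln x\<bar> + \<bar>?Q\<bar>"
          by (rule order_trans[OF abs_triangle_ineq4]) (simp add: abs_mult)
        also have "\<dots> \<le> \<bar>?P\<bar> * (2 * (1 + a) / sqrt x) + \<bar>?Q\<bar> * (sqrt a / sqrt x)"
          using x x0 mult_left_mono[of 1 "sqrt a / sqrt x" "\<bar>?Q\<bar>"]
          by (intro add_mono mult_left_mono abs_ln_le_sqrt) auto
        finally have "\<bar>?P * ln x - ?Q\<bar> \<le> (\<bar>?P\<bar> * (2 * (1 + a)) + \<bar>?Q\<bar> * sqrt a) / sqrt x"
          by (simp only: add_divide_distrib times_divide_eq_right)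
        moreover have "x powr (2 * real k + 1 - real 0) = x ^ (2*k) * x"
          using x0 powr_realpow[of x "2*k+1"] by (simp add: mult.commute add.commute)
        moreover have "x ^ (2*k) * x \<le> a ^ (2*k) * x"
          using x by (intro mult_right_mono power_mono) auto
        ultimately have "\<bar>log_chain k 0 x\<bar> \<le> (\<bar>?P\<bar> * (2 * (1 + a)) + \<bar>?Q\<bar> * sqrt a) / sqrt x * (a ^ (2*k) * x)"
          unfolding log_chain_def abs_mult using x x0 assms
          by (intro mult_mono) (auto simp del: antideriv_coeff.simps antideriv_coeff'.simps)
        also have "\<dots> = ((\<bar>?P\<bar> * (2 * (1 + a)) + \<bar>?Q\<bar> * sqrt a) * a ^ (2*k)) * (x / sqrt x)"
          by simp
        also have "x / sqrt x = sqrt x" using x(1) by (rule real_div_sqrt)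
        finally show ?thesis .
      qed (simp add: log_chain_at_0)
    qed
  qed (use assms in auto)
  then show ?thesis by (simp add: log_chain_at_0)
qed

lemma sum_inverse_sqrt: "(\<Sum>n=1..M. 1 / sqrt (real n)) \<le> 2 * sqrt (real M)"
proof (induction M)
  case (Suc M)
  let ?x = "sqrt (real M)" and ?y = "sqrt (real (Suc M))"
  have y: "?y > 0" and xy: "?x \<le> ?y" and d: "?y * ?y - ?x * ?x = 1" by simp_all
  \<comment> \<open>This is (y - x)^2 >= 0 with y^2 - x^2 = 1; divided by y, it says that 2 sqrt
    grows by at least 1 / y.\<close>
  have "2 * ?x * ?y + 1 \<le> 2 * (?y * ?y)"
    using zero_le_square[of "?y - ?x"] d by (simp only: algebra_simps)
  then have "2 * ?x + 1 / ?y \<le> 2 * ?y"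
    using y by (simp add: field_simps)
  then show ?case using Suc by simp
qed simp

text \<open>Derivatives of ln * R, shifted by one so that index 0 is the antiderivative.\<close>

definition ln_prim :: "(nat \<Rightarrow> real \<Rightarrow> real) \<Rightarrow> nat \<Rightarrow> real \<Rightarrow> real" where
  "ln_prim R j x = (case j of 0 \<Rightarrow> integral {0..x} (\<lambda>y. ln y * R 0 y) | Suc i \<Rightarrow> leibniz ln_chain R i x)"

lemma ln_prim_0: "ln_prim R 0 x = integral {0..x} (\<lambda>y. ln y * R 0 y)"
  and ln_prim_Suc: "ln_prim R (Suc i) x = leibniz ln_chain R i x"
  by (simp_all add: ln_prim_def)

lemma power_div_sqrt:
  fixes x :: real
  assumes "x \<ge> 0"
  shows "x ^ Suc m / sqrt x = x ^ m * sqrt x"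
  using real_div_sqrt[OF assms] by (metis power_Suc2 times_divide_eq_right)

lemma step_size_pos: "a > 0 \<Longrightarrow> step_size a M > 0"
  by (simp add: step_size_def)

lemma step_size_mult: "(real M + 1/2) * step_size a M = a"
proof -
  have "real M + 1/2 \<noteq> 0" by linarith
  then show ?thesis by (simp add: step_size_def)
qed

text \<open>Member j of \<open>ln_prim R\<close> is O(x^(q-j+1/2)), so with the factor h^j the
  boundary terms at h/2 are absorbed into O(h^q) and only those at a remain. Continuity of the
  integrand at 0 is needed to differentiate the integral that forms member 0.\<close>

lemma em_ln_flat:
  assumes q: "q = Suc q'" "q' \<ge> 1" and a: "a > 0" and B0: "B \<ge> 0"
    and der: "\<And>j x. \<lbrakk>j < q; x \<in> {0..a}\<rbrakk> \<Longrightarrow> (R j has_real_derivative R (Suc j) x) (at x within {0..a})"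
    and R: "\<And>j x. \<lbrakk>j \<le> q; 0 \<le> x; x \<le> a\<rbrakk> \<Longrightarrow> \<bar>R j x\<bar> \<le> B * x ^ (q - j)"
  shows "continuous_on {0..a} (\<lambda>x. ln x * R 0 x)"
    and "\<exists>C. \<forall>M\<ge>1. \<bar>(\<Sum>n=1..M. step_size a M * (ln (real n * step_size a M) * R 0 (real n * step_size a M)))
              - (\<Sum>j\<le>q. em_coeff j * step_size a M ^ j * ln_prim R j a)\<bar> \<le> C * step_size a M ^ q"
proof -
  obtain C where C0: "C \<ge> 0"
    and C: "\<And>j x. \<lbrakk>j \<le> q; 0 < x; x \<le> a\<rbrakk> \<Longrightarrow> \<bar>leibniz ln_chain R j x\<bar> \<le> C * x ^ (q - j) / sqrt x"
    using leibniz_ln_bound[of q a R B] R by blast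
  have C1: "\<bar>ln x * R 0 x\<bar> \<le> C * (x ^ q' * sqrt x)" if x: "0 \<le> x" "x \<le> a" for x
  proof (cases "x = 0")
    case False
    then have "\<bar>ln x * R 0 x\<bar> \<le> C * (x ^ Suc q' / sqrt x)"
      using C[of 0 x] x q(1) by simp
    then show ?thesis unfolding power_div_sqrt[OF x(1)] .
  qed simp
  show cont: "continuous_on {0..a} (\<lambda>x. ln x * R 0 x)"
  proof (rule continuous_on_from_sqrt_bound)
    fix x assume x: "0 < x" "x \<le> a"
    have "continuous (at x within {0..a}) (R 0)"
      using der[of 0 x] q x by (intro DERIV_continuous) auto
    then show "continuous (at x within {0..a}) (\<lambda>x. ln x * R 0 x)"
      using x by (intro continuous_intros) auto
  next
    fix x assume x: "0 \<le> x" "x \<le> a"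
    have "C * (x ^ q' * sqrt x) \<le> C * (a ^ q' * sqrt x)"
      using x C0 by (intro mult_left_mono mult_right_mono power_mono) auto
    then show "\<bar>ln x * R 0 x\<bar> \<le> C * a ^ q' * sqrt x"
      using C1[OF x] by (simp add: mult.assoc)
  qed
  have bound: "\<bar>ln_prim R j x\<bar> \<le> C * (x ^ (q - j) * sqrt x)" if "j \<le> q" "0 < x" "x \<le> a" for j x
  proof (cases j)
    case 0
    have int: "(\<lambda>y. ln y * R 0 y) integrable_on {0..x}"
      using that by (intro integrable_continuous_real continuous_on_subset[OF cont]) auto
    have "norm (integral {0..x} (\<lambda>y. ln y * R 0 y)) \<le> integral {0..x} (\<lambda>y. C * (x ^ q' * sqrt x))"
    proof (rule integral_norm_bound_integral[OF int])
      fix y assume y: "y \<in> {0..x}"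
      have "C * (y ^ q' * sqrt y) \<le> C * (x ^ q' * sqrt x)"
        using y C0 by (intro mult_left_mono mult_mono power_mono) auto
      then show "norm (ln y * R 0 y) \<le> C * (x ^ q' * sqrt x)"
        using C1[of y] y that by simp
    qed (rule integrable_const_ivl)
    then show ?thesis using 0 q(1) that by (simp add: ln_prim_0 mult_ac)
  next
    case (Suc i)
    then have "q - i = Suc (q - j)" using that by simp
    have "\<bar>leibniz ln_chain R i x\<bar> \<le> C * (x ^ (q - i) / sqrt x)"
      using C[of i x] that Suc by simp
    also have "x ^ (q - i) / sqrt x = x ^ (q - j) * sqrt x"
      unfolding \<open>q - i = Suc (q - j)\<close> using that by (intro power_div_sqrt) simp
    finally show ?thesis by (simp add: Suc ln_prim_Suc)
  qed
  have deriv: "(ln_prim R j has_real_derivative ln_prim R (Suc j) x) (at x within {0..a})"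
    if "j \<le> q" "0 < x" "x \<le> a" for j x
  proof (cases j)
    case 0
    have "((\<lambda>x. integral {0..x} (\<lambda>y. ln y * R 0 y)) has_real_derivative ln x * R 0 x) (at x within {0..a})"
      using that by (intro integral_has_real_derivative cont) auto
    then show ?thesis using 0 by (simp add: ln_prim_def[abs_def])
  next
    case (Suc i)
    have "(leibniz ln_chain R i has_real_derivative leibniz ln_chain R (Suc i) x) (at x within {0..a})"
      using that Suc by (intro leibniz_deriv ln_chain_deriv der) auto
    then show ?thesis using Suc by (simp add: ln_prim_def[abs_def])
  qed
  \<comment> \<open>4 C sqrt a bounds the cell errors: the sum of 1 / sqrt n is at most 2 sqrt M, h
    / sqrt (h/2) is 2 sqrt (h/2), and M h / 2 <= a. The second summand bounds the terms at
    h/2.\<close>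
  define D where "D = em_const q * (4 * C * sqrt a) + (\<Sum>j\<le>q. \<bar>em_coeff j\<bar> * (C * sqrt a))"
  show "\<exists>C. \<forall>M\<ge>1. \<bar>(\<Sum>n=1..M. step_size a M * (ln (real n * step_size a M) * R 0 (real n * step_size a M)))
              - (\<Sum>j\<le>q. em_coeff j * step_size a M ^ j * ln_prim R j a)\<bar> \<le> C * step_size a M ^ q"
  proof (intro exI[of _ D] allI impI)
    fix M :: nat assume M: "M \<ge> 1"
    define h where "h = step_size a M"
    have h: "h > 0" unfolding h_def using a by (rule step_size_pos)
    have hM: "(real M + 1/2) * h = a" unfolding h_def by (rule step_size_mult)
    then have Mh2: "real M * h + h / 2 = a" by (simp add: distrib_right)
    moreover have "0 \<le> real M * h" using h by simp
    ultimately have Mh: "real M * h \<le> a" "h / 2 \<le> a" using h by linarith+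
    let ?T = "\<lambda>x. \<Sum>j\<le>q. (em_coeff j * h ^ j) * ln_prim R j x"
    have "norm ((\<Sum>n=1..M. h *\<^sub>R ln_prim R 1 (real n * h))
            - (\<Sum>j\<le>q. (em_coeff j * h ^ j) *\<^sub>R (ln_prim R j ((real M + 1/2) * h) - ln_prim R j (h/2))))
           \<le> em_const q * (h ^ Suc q * (\<Sum>n=1..M. C / sqrt (real n * h / 2)))"
    proof (rule em_sum[OF h])
      fix j x assume jx: "j \<le> q" "x \<in> {h/2..(real M + 1/2) * h}"
      then have "(ln_prim R j has_real_derivative ln_prim R (Suc j) x) (at x within {0..a})"
        using h unfolding hM by (intro deriv) auto
      then have "(ln_prim R j has_real_derivative ln_prim R (Suc j) x) (at x within {h/2..(real M + 1/2) * h})"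
        by (rule DERIV_subset) (use h hM in auto)
      then show "(ln_prim R j has_vector_derivative ln_prim R (Suc j) x) (at x within {h/2..(real M + 1/2) * h})"
        by (simp add: has_real_derivative_iff_has_vector_derivative)
    next
      fix n x assume n: "n \<in> {1..M}" and x: "x \<in> {real n * h - h/2..real n * h + h/2}"
      have nh: "h \<le> real n * h" "real n * h \<le> real M * h" using n h by simp_all
      \<comment> \<open>As n >= 1, the cell around n h lies to the right of n h / 2, which keeps 1 /
        sqrt x under control.\<close>
      have xl: "real n * h / 2 \<le> x" "x \<le> a" "0 < x" "0 < real n * h / 2"
        using x nh h Mh2 unfolding atLeastAtMost_iff by linarith+
      have "\<bar>ln_prim R (Suc q) x\<bar> \<le> C / sqrt x"
        using C[of q x] xl by (simp add: ln_prim_Suc)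
      also have "\<dots> \<le> C / sqrt (real n * h / 2)"
        using xl C0 by (intro divide_left_mono mult_pos_pos) auto
      finally show "norm (ln_prim R (Suc q) x) \<le> C / sqrt (real n * h / 2)" by simp
    qed (use q in simp)
    also have "\<dots> \<le> em_const q * (h ^ q * (4 * C * sqrt a))"
    proof -
      have "(\<Sum>n=1..M. C / sqrt (real n * h / 2)) = C / sqrt (h / 2) * (\<Sum>n=1..M. 1 / sqrt (real n))"
        unfolding sum_distrib_left by (intro sum.cong refl) (simp add: real_sqrt_mult real_sqrt_divide)
      also have "\<dots> \<le> C / sqrt (h / 2) * (2 * sqrt (real M))"
        using C0 h by (intro mult_left_mono sum_inverse_sqrt) auto
      finally have "h * (\<Sum>n=1..M. C / sqrt (real n * h / 2)) \<le> h * (C / sqrt (h / 2) * (2 * sqrt (real M)))"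
        using h by (intro mult_left_mono) auto
      also have "\<dots> = 4 * C * sqrt (real M) * ((h / 2) / sqrt (h / 2))" by simp
      also have "(h / 2) / sqrt (h / 2) = sqrt (h / 2)"
        using h by (intro real_div_sqrt) simp
      also have "4 * C * sqrt (real M) * sqrt (h / 2) = 4 * C * sqrt (real M * h / 2)"
        by (simp add: real_sqrt_mult real_sqrt_divide)
      also have "\<dots> \<le> 4 * C * sqrt a"
        using Mh h C0 by (intro mult_left_mono real_sqrt_le_mono) auto
      finally have "h ^ q * (h * (\<Sum>n=1..M. C / sqrt (real n * h / 2))) \<le> h ^ q * (4 * C * sqrt a)"
        using h by (intro mult_left_mono) auto
      then show ?thesis
        by (intro mult_left_mono em_const_nonneg) (simp add: mult_ac)
    qed
    finally have 1: "\<bar>(\<Sum>n=1..M. h * ln_prim R 1 (real n * h)) - (?T a - ?T (h/2))\<bar>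
        \<le> em_const q * (h ^ q * (4 * C * sqrt a))"
      unfolding hM by (simp add: right_diff_distrib sum_subtractf)
    have 2: "\<bar>?T (h/2)\<bar> \<le> h ^ q * (\<Sum>j\<le>q. \<bar>em_coeff j\<bar> * (C * sqrt a))"
    proof -
      have "\<bar>?T (h/2)\<bar> \<le> (\<Sum>j\<le>q. \<bar>em_coeff j * h ^ j * ln_prim R j (h/2)\<bar>)"
        by (rule sum_abs)
      also have "\<dots> \<le> (\<Sum>j\<le>q. h ^ q * (\<bar>em_coeff j\<bar> * (C * sqrt a)))"
      proof (rule sum_mono)
        fix j assume "j \<in> {..q}"
        then have j: "j \<le> q" by simp
        have "\<bar>ln_prim R j (h/2)\<bar> \<le> C * ((h/2) ^ (q - j) * sqrt (h/2))"
          using j h Mh by (intro bound) auto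
        also have "\<dots> \<le> C * (h ^ (q - j) * sqrt a)"
          using h Mh C0 by (intro mult_left_mono mult_mono power_mono) auto
        finally have "h ^ j * \<bar>ln_prim R j (h/2)\<bar> \<le> h ^ j * (C * (h ^ (q - j) * sqrt a))"
          using h by (intro mult_left_mono) auto
        also have "\<dots> = (h ^ j * h ^ (q - j)) * (C * sqrt a)" by simp
        also have "h ^ j * h ^ (q - j) = h ^ q" using j by (simp flip: power_add)
        finally have "\<bar>em_coeff j\<bar> * (h ^ j * \<bar>ln_prim R j (h/2)\<bar>) \<le> \<bar>em_coeff j\<bar> * (h ^ q * (C * sqrt a))"
          by (intro mult_left_mono) auto
        then show "\<bar>em_coeff j * h ^ j * ln_prim R j (h/2)\<bar> \<le> h ^ q * (\<bar>em_coeff j\<bar> * (C * sqrt a))"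
          using h by (simp add: abs_mult mult_ac)
      qed
      finally show ?thesis by (simp add: sum_distrib_left)
    qed
    have "\<bar>(\<Sum>n=1..M. h * ln_prim R 1 (real n * h)) - ?T a\<bar> \<le> D * h ^ q"
    proof -
      have "D * h ^ q = em_const q * (h ^ q * (4 * C * sqrt a)) + h ^ q * (\<Sum>j\<le>q. \<bar>em_coeff j\<bar> * (C * sqrt a))"
        by (simp add: D_def algebra_simps)
      then show ?thesis using 1 2 by linarith
    qed
    then show "\<bar>(\<Sum>n=1..M. step_size a M * (ln (real n * step_size a M) * R 0 (real n * step_size a M)))
              - (\<Sum>j\<le>q. em_coeff j * step_size a M ^ j * ln_prim R j a)\<bar> \<le> D * step_size a M ^ q"
      by (simp add: h_def ln_prim_Suc)
  qed
qed

section \<open>Logarithm times an even monomial at step length h\<close>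

lemma em_log_scaled:
  assumes q: "q \<ge> 2*k+1" and a: "a > 0" and h: "h = step_size a M"
  shows "(\<Sum>n=1..M. h * (ln (real n * h) * (real n * h) ^ (2*k)))
            - (\<Sum>j\<le>q. em_coeff j * h ^ j * log_chain k j a)
         = h ^ (2*k+1) * (em_log q k M + ln h * (if k = 0 then - 1/2 else 0))"
proof -
  have h0: "h > 0" using h a step_size_pos by simp
  have L: "real M + 1/2 > 0" by simp
  have "(\<Sum>n=1..M. h * (ln (real n * h) * (real n * h) ^ (2*k)))
      = (\<Sum>n=1..M. h ^ (2*k+1) * (real n ^ (2*k) * ln (real n) + ln h * real n ^ (2*k)))"
    by (intro sum.cong refl) (use h0 in \<open>simp add: ln_mult power_mult_distrib algebra_simps\<close>)
  also have "\<dots> = h ^ (2*k+1) * ((\<Sum>n=1..M. real n ^ (2*k) * ln (real n)) + ln h * (\<Sum>n=1..M. real n ^ (2*k)))"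
    by (simp add: sum_distrib_left sum.distrib distrib_left)
  finally have 1: "(\<Sum>n=1..M. h * (ln (real n * h) * (real n * h) ^ (2*k))) = \<dots>" .
  have "(\<Sum>j\<le>q. em_coeff j * h ^ j * log_chain k j a)
      = (\<Sum>j\<le>q. em_coeff j * (h ^ (2*k+1) * (log_chain k j (real M + 1/2) + ln h * pow_chain k j (real M + 1/2))))"
  proof (intro sum.cong refl)
    fix j
    have "a = h * (real M + 1/2)" using step_size_mult[of M a] h by (simp add: mult.commute)
    then show "em_coeff j * h ^ j * log_chain k j a
        = em_coeff j * (h ^ (2*k+1) * (log_chain k j (real M + 1/2) + ln h * pow_chain k j (real M + 1/2)))"
      using log_chain_scale[OF L h0, of j k] by (simp only: mult.assoc)
  qed
  also have "\<dots> = h ^ (2*k+1) * ((\<Sum>j\<le>q. em_coeff j * log_chain k j (real M + 1/2))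
      + ln h * (\<Sum>j\<le>q. em_coeff j * pow_chain k j (real M + 1/2)))"
    by (simp add: sum_distrib_left sum.distrib distrib_left mult_ac)
  finally have 2: "(\<Sum>j\<le>q. em_coeff j * h ^ j * log_chain k j a) = \<dots>" .
  show ?thesis
    unfolding 1 2 em_pow_exact[OF q, of M, symmetric] em_log_def
    by (simp only: right_diff_distrib distrib_left)
qed

lemma em_log_scaled_bound:
  assumes q: "q = 2*K+2" and k: "k \<le> K" and a: "a > 0"
    and Z: "- deriv riemann_zeta (- of_nat (2*k)) = complex_of_real Z"
  shows "\<exists>C. \<forall>M\<ge>1. \<bar>(\<Sum>n=1..M. step_size a M * (ln (real n * step_size a M) * (real n * step_size a M) ^ (2*k)))
            - (\<Sum>j\<le>q. em_coeff j * step_size a M ^ j * log_chain k j a)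
            - (step_size a M ^ (2*k+1) * Z - (if k = 0 then step_size a M * ln (step_size a M) / 2 else 0))\<bar>
          \<le> C * step_size a M ^ q"
proof -
  define r where "r = q - 2*k - 2"
  have r: "q = 2*k + r + 2" using q k by (simp add: r_def)
  obtain C where C: "\<And>M. M \<ge> 1 \<Longrightarrow> \<bar>Z - em_log q k M\<bar> \<le> C / real M ^ (r + 1)"
    using em_log_rate[OF r Z] by blast
  have C0: "C \<ge> 0" using C[of 1] by simp
  show ?thesis
  proof (intro exI[of _ "C * (2 / a) ^ (r+1)"] allI impI)
    fix M :: nat assume M: "M \<ge> 1"
    define h where "h = step_size a M"
    have h: "h > 0" unfolding h_def using a by (rule step_size_pos)
    have hM: "(real M + 1/2) * h = a" unfolding h_def by (rule step_size_mult)
    \<comment> \<open>M + 1/2 <= 2 M; this converts powers of 1/M into powers of h.\<close>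
    have "a \<le> (2 * real M) * h"
      unfolding hM[symmetric] using M h by (intro mult_right_mono) auto
    then have "1 / real M \<le> h * (2 / a)" using M a by (simp add: field_simps)
    then have "(1 / real M) ^ (r+1) \<le> (h * (2 / a)) ^ (r+1)" by (rule power_mono) simp
    then have "C * (1 / real M) ^ (r+1) \<le> C * (h * (2 / a)) ^ (r+1)"
      using C0 by (rule mult_left_mono)
    then have "\<bar>Z - em_log q k M\<bar> \<le> C * (h * (2 / a)) ^ (r+1)"
      using C[OF M] by (simp add: power_one_over del: power_Suc)
    then have "h ^ (2*k+1) * \<bar>Z - em_log q k M\<bar> \<le> h ^ (2*k+1) * (C * (h * (2 / a)) ^ (r+1))"
      using h by (intro mult_left_mono) auto
    also have "\<dots> = C * (2 / a) ^ (r+1) * h ^ q"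
      unfolding power_mult_distrib r by (simp add: power_add mult_ac)
    finally have bd: "\<bar>h ^ (2*k+1) * (em_log q k M - Z)\<bar> \<le> C * (2 / a) ^ (r+1) * h ^ q"
      using h by (simp add: abs_mult abs_minus_commute)
    have "(\<Sum>n=1..M. h * (ln (real n * h) * (real n * h) ^ (2*k)))
            - (\<Sum>j\<le>q. em_coeff j * h ^ j * log_chain k j a)
            - (h ^ (2*k+1) * Z - (if k = 0 then h * ln h / 2 else 0)) = h ^ (2*k+1) * (em_log q k M - Z)"
      using q k a by (subst em_log_scaled[OF _ _ h_def]) (auto simp: algebra_simps)
    with bd show "\<bar>(\<Sum>n=1..M. step_size a M * (ln (real n * step_size a M) * (real n * step_size a M) ^ (2*k)))
            - (\<Sum>j\<le>q. em_coeff j * step_size a M ^ j * log_chain k j a)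
            - (step_size a M ^ (2*k+1) * Z - (if k = 0 then step_size a M * ln (step_size a M) / 2 else 0))\<bar>
          \<le> C * (2 / a) ^ (r+1) * step_size a M ^ q"
      unfolding h_def by simp
  qed
qed

text \<open>On the half interval [0, a], evenness is expressed by vanishing odd derivatives at 0 and
  compact support by vanishing derivatives at a. The weights do not appear yet: \<open>Z k\<close>
  is the real number -zeta'(-2k).\<close>

lemma em_ln_core:
  assumes q: "q = 2*K+2" and a: "a > 0"
    and der: "\<And>j x. \<lbrakk>j < q; x \<in> {0..a}\<rbrakk> \<Longrightarrow> (F j has_real_derivative F (Suc j) x) (at x within {0..a})"
    and cont: "continuous_on {0..a} (F q)"
    and odd: "\<And>j. \<lbrakk>j < q; odd j\<rbrakk> \<Longrightarrow> F j 0 = 0"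
    and flat: "\<And>j. j < q \<Longrightarrow> F j a = 0"
    and Z: "\<And>k. k \<le> K \<Longrightarrow> - deriv riemann_zeta (- of_nat (2*k)) = complex_of_real (Z k)"
  shows "\<exists>C. \<forall>M\<ge>1. \<bar>(\<Sum>n=1..M. step_size a M * (ln (real n * step_size a M) * F 0 (real n * step_size a M)))
            - integral {0..a} (\<lambda>x. ln x * F 0 x)
            - ((\<Sum>k\<le>K. even_coeff F k * (step_size a M ^ (2*k+1) * Z k)) - F 0 0 * (step_size a M * ln (step_size a M)) / 2)\<bar>
          \<le> C * step_size a M ^ q"
proof -
  define c where "c = even_coeff F"
  define R where "R = even_rem K F"
  obtain B where B0: "B \<ge> 0" and B: "\<And>j x. \<lbrakk>j \<le> q; 0 \<le> x; x \<le> a\<rbrakk> \<Longrightarrow> \<bar>R j x\<bar> \<le> B * x ^ (q - j)"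
    using even_rem_bound[OF q a der cont odd] unfolding R_def by blast
  have Rder: "(R j has_real_derivative R (Suc j) x) (at x within {0..a})" if "j < q" "x \<in> {0..a}" for j x
    unfolding R_def using der[OF that] by (rule even_rem_deriv)
  have F: "F j x = R j x + (\<Sum>k\<le>K. c k * pow_chain k (Suc j) x)" for j x
    by (simp add: R_def c_def even_rem_def)
  have F0: "F 0 x = R 0 x + (\<Sum>k\<le>K. c k * x ^ (2*k))" for x
    using F[of 0] pow_chain_1 by simp
  have q': "q = Suc (2*K+1)" "1 \<le> 2*K+1" using q by auto
  note flatR = em_ln_flat[OF q' a B0 Rder B]
  obtain C where C: "\<And>M. M \<ge> 1 \<Longrightarrow> \<bar>(\<Sum>n=1..M. step_size a M * (ln (real n * step_size a M) * R 0 (real n * step_size a M)))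
              - (\<Sum>j\<le>q. em_coeff j * step_size a M ^ j * ln_prim R j a)\<bar> \<le> C * step_size a M ^ q"
    using flatR(2) by blast
  \<comment> \<open>With the bound as a predicate in its constant, one constant per k can be chosen
    for the finite sum over k.\<close>
  define P where "P k e \<longleftrightarrow> (\<forall>M\<ge>1. \<bar>(\<Sum>n=1..M. step_size a M * (ln (real n * step_size a M) * (real n * step_size a M) ^ (2*k)))
            - (\<Sum>j\<le>q. em_coeff j * step_size a M ^ j * log_chain k j a)
            - (step_size a M ^ (2*k+1) * Z k - (if k = 0 then step_size a M * ln (step_size a M) / 2 else 0))\<bar>
          \<le> e * step_size a M ^ q)" for k e
  have "\<exists>e. P k e" if "k \<le> K" for k
    unfolding P_def by (rule em_log_scaled_bound[OF q that a Z[OF that]])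
  then have "\<forall>k. \<exists>e. k \<le> K \<longrightarrow> P k e" by blast
  then obtain E where E: "\<And>k. k \<le> K \<Longrightarrow> P k (E k)" using choice[of "\<lambda>k e. k \<le> K \<longrightarrow> P k e"] by blast
  \<comment> \<open>The chain of ln * F, evaluated at a: member 0 is the integral, and the others
    are Leibniz sums over derivatives of F at a, hence 0.\<close>
  define G where "G j = ln_prim R j a + (\<Sum>k\<le>K. c k * log_chain k j a)" for j
  have G0: "G 0 = integral {0..a} (\<lambda>x. ln x * F 0 x)"
  proof -
    have "((\<lambda>x. ln x * R 0 x + (\<Sum>k\<le>K. c k * (ln x * x ^ (2*k)))) has_integral G 0) {0..a}"
      unfolding G_def ln_prim_0
      by (intro has_integral_add has_integral_sum has_integral_mult_right log_chain_0_integral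
          integrable_integral integrable_continuous_real flatR(1) a) auto
    moreover have "(\<lambda>x. ln x * R 0 x + (\<Sum>k\<le>K. c k * (ln x * x ^ (2*k)))) = (\<lambda>x. ln x * F 0 x)"
      unfolding F0 by (simp add: distrib_left sum_distrib_left mult_ac)
    ultimately show ?thesis by (simp add: integral_unique)
  qed
  have GS: "G (Suc j) = 0" if "Suc j \<le> q" for j
  proof -
    have "G (Suc j) = leibniz ln_chain R j a + (\<Sum>k\<le>K. c k * leibniz ln_chain (\<lambda>i. pow_chain k (Suc i)) j a)"
      unfolding G_def ln_prim_Suc ln_chain_leibniz_pow[OF a] ..
    also have "\<dots> = leibniz ln_chain F j a"
      unfolding leibniz_def F sum_distrib_left distrib_left sum.distrib
      by (subst sum.swap) (simp add: mult_ac)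
    also have "\<dots> = 0"
      unfolding leibniz_def using that flat by (intro sum.neutral) auto
    finally show ?thesis .
  qed
  have Gsum: "(\<Sum>j\<le>q. em_coeff j * h ^ j * G j) = integral {0..a} (\<lambda>x. ln x * F 0 x)" for h :: real
  proof -
    have "(\<Sum>j\<le>q. em_coeff j * h ^ j * G j) = (\<Sum>j\<le>q. if j = 0 then G 0 else 0)"
    proof (rule sum.cong[OF refl])
      fix j assume "j \<in> {..q}"
      then show "em_coeff j * h ^ j * G j = (if j = 0 then G 0 else 0)"
        using GS by (cases j) auto
    qed
    then show ?thesis by (simp add: G0)
  qed
  define D where "D = C + (\<Sum>k\<le>K. \<bar>c k\<bar> * E k)"
  show ?thesis
  proof (intro exI[of _ D] allI impI)
    fix M :: nat assume M: "M \<ge> 1"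
    define h where "h = step_size a M"
    define S where "S = (\<Sum>n=1..M. h * (ln (real n * h) * F 0 (real n * h)))"
    define X where "X = (\<Sum>n=1..M. h * (ln (real n * h) * R 0 (real n * h))) - (\<Sum>j\<le>q. em_coeff j * h ^ j * ln_prim R j a)"
    define Y where "Y k = (\<Sum>n=1..M. h * (ln (real n * h) * (real n * h) ^ (2*k)))
            - (\<Sum>j\<le>q. em_coeff j * h ^ j * log_chain k j a)" for k
    define W where "W k = h ^ (2*k+1) * Z k - (if k = 0 then h * ln h / 2 else 0)" for k
    have X: "\<bar>X\<bar> \<le> C * h ^ q" unfolding X_def h_def using M by (rule C)
    have Y: "\<bar>Y k - W k\<bar> \<le> E k * h ^ q" if "k \<le> K" for k
      using E[OF that] M unfolding P_def Y_def W_def h_def by blast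
    have "S - integral {0..a} (\<lambda>x. ln x * F 0 x) = X + (\<Sum>k\<le>K. c k * Y k)"
    proof -
      have "S = (\<Sum>n=1..M. h * (ln (real n * h) * R 0 (real n * h)))
          + (\<Sum>k\<le>K. c k * (\<Sum>n=1..M. h * (ln (real n * h) * (real n * h) ^ (2*k))))"
        unfolding S_def F0 sum_distrib_left distrib_left sum.distrib
        by (subst sum.swap) (simp add: mult_ac)
      moreover have "integral {0..a} (\<lambda>x. ln x * F 0 x) = (\<Sum>j\<le>q. em_coeff j * h ^ j * ln_prim R j a)
          + (\<Sum>k\<le>K. c k * (\<Sum>j\<le>q. em_coeff j * h ^ j * log_chain k j a))"
        unfolding Gsum[of h, symmetric] G_def sum_distrib_left distrib_left sum.distrib
        by (subst sum.swap) (simp add: mult_ac)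
      ultimately show ?thesis
        by (simp add: X_def Y_def right_diff_distrib sum_subtractf)
    qed
    moreover have "(\<Sum>k\<le>K. c k * W k) = (\<Sum>k\<le>K. c k * (h ^ (2*k+1) * Z k)) - F 0 0 * (h * ln h) / 2"
    proof -
      have "(\<Sum>k\<le>K. c k * W k) = (\<Sum>k\<le>K. c k * (h ^ (2*k+1) * Z k)) - (\<Sum>k\<le>K. if k = 0 then c 0 * (h * ln h / 2) else 0)"
        unfolding W_def right_diff_distrib sum_subtractf by (intro arg_cong2[where f = minus] sum.cong) auto
      moreover have "c 0 = F 0 0" by (simp add: c_def even_coeff_def)
      ultimately show ?thesis by simp
    qed
    ultimately have "S - integral {0..a} (\<lambda>x. ln x * F 0 x)
        - ((\<Sum>k\<le>K. c k * (h ^ (2*k+1) * Z k)) - F 0 0 * (h * ln h) / 2) = X + (\<Sum>k\<le>K. c k * (Y k - W k))"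
      by (simp add: right_diff_distrib sum_subtractf)
    also have "\<bar>\<dots>\<bar> \<le> \<bar>X\<bar> + (\<Sum>k\<le>K. \<bar>c k * (Y k - W k)\<bar>)"
      by (rule order_trans[OF abs_triangle_ineq]) (simp add: sum_abs)
    also have "\<dots> \<le> C * h ^ q + (\<Sum>k\<le>K. \<bar>c k\<bar> * (E k * h ^ q))"
      unfolding abs_mult by (intro add_mono X sum_mono mult_left_mono Y) auto
    also have "\<dots> = D * h ^ q"
      by (simp add: D_def distrib_right sum_distrib_right mult.assoc)
    finally show "\<bar>(\<Sum>n=1..M. step_size a M * (ln (real n * step_size a M) * F 0 (real n * step_size a M)))
            - integral {0..a} (\<lambda>x. ln x * F 0 x)
            - ((\<Sum>k\<le>K. even_coeff F k * (step_size a M ^ (2*k+1) * Z k)) - F 0 0 * (step_size a M * ln (step_size a M)) / 2)\<bar>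
          \<le> D * step_size a M ^ q"
      unfolding S_def h_def c_def .
  qed
qed

section \<open>The corrected trapezoidal rule\<close>

text \<open>\<open>C_on\<close> hides one existential quantifier per derivative; the chain form used
  throughout needs all derivatives in a single family.\<close>

lemma C_on_chain:
  assumes "C_on p S f"
  obtains u where "u 0 = f"
    "\<And>j x. \<lbrakk>j < p; x \<in> S\<rbrakk> \<Longrightarrow> (u j has_real_derivative u (Suc j) x) (at x within S)"
    "\<And>j. j \<le> p \<Longrightarrow> continuous_on S (u j)"
proof -
  have "\<exists>u. u 0 = f \<and> (\<forall>j<p. \<forall>x\<in>S. (u j has_real_derivative u (Suc j) x) (at x within S)) \<and> continuous_on S (u p)"
    using assms
  proof (induction p arbitrary: f)
    case 0
    then show ?case by (intro exI[of _ "\<lambda>_. f"]) simp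
  next
    case (Suc p)
    then obtain f' where f': "\<forall>x\<in>S. (f has_real_derivative f' x) (at x within S)" "C_on p S f'"
      by auto
    from Suc.IH[OF f'(2)] obtain u where u: "u 0 = f'"
      "\<forall>j<p. \<forall>x\<in>S. (u j has_real_derivative u (Suc j) x) (at x within S)" "continuous_on S (u p)"
      by blast
    show ?case
      by (rule exI[of _ "case_nat f u"]) (use u f'(1) in \<open>auto simp: less_Suc_eq_0_disj\<close>)
  qed
  then obtain u where u: "u 0 = f"
      "\<And>j x. \<lbrakk>j < p; x \<in> S\<rbrakk> \<Longrightarrow> (u j has_real_derivative u (Suc j) x) (at x within S)" "continuous_on S (u p)"
    by blast
  have "continuous_on S (u j)" if "j \<le> p" for j
    using that u(2,3) DERIV_continuous_on[of S "u j" "u (Suc j)"] by (cases "j = p") auto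
  with u show ?thesis using that by blast
qed

lemma higher_deriv_chain:
  assumes "\<And>j x. j < p \<Longrightarrow> (u j has_real_derivative u (Suc j) x) (at x)" and "k \<le> p"
  shows "(deriv ^^ k) (u 0) = u k"
  using \<open>k \<le> p\<close>
proof (induction k)
  case (Suc k)
  then have "(deriv ^^ Suc k) (u 0) = deriv (u k)" by simp
  also have "\<dots> = u (Suc k)"
    using assms(1)[of k] Suc.prems by (intro ext DERIV_imp_deriv) auto
  finally show ?case .
qed simp

text \<open>Beyond a every member vanishes, as a derivative is determined on an open set; continuity
  from the right carries this to a.\<close>

lemma chain_vanishes_at_boundary:
  fixes u :: "nat \<Rightarrow> real \<Rightarrow> real"
  assumes der: "\<And>j x. j < p \<Longrightarrow> (u j has_real_derivative u (Suc j) x) (at x)"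
    and zero: "\<And>x. x > a \<Longrightarrow> u 0 x = 0" and "j < p"
  shows "u j a = 0"
proof -
  have out: "u j x = 0" if "x > a" for x
    using \<open>j < p\<close> that
  proof (induction j arbitrary: x)
    case (Suc j)
    have "((\<lambda>_. 0) has_real_derivative u (Suc j) x) (at x)"
      by (rule has_field_derivative_transform_within_open[OF der[of j x], where S = "{a<..}"]) (use Suc in auto)
    then show ?case using DERIV_const by (rule DERIV_unique)
  qed (use zero in simp)
  have "continuous (at a) (u j)"
    using der[OF \<open>j < p\<close>] by (rule DERIV_isCont)
  then have "(u j \<longlongrightarrow> u j a) (at_right a)"
    by (simp add: continuous_within filterlim_at_split isCont_def)
  moreover have "(u j \<longlongrightarrow> 0) (at_right a)"
    by (rule tendsto_eventually) (use out in \<open>auto simp: eventually_at_filter\<close>)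
  ultimately show ?thesis
    using tendsto_unique trivial_limit_at_right_real by blast
qed

text \<open>u is split as u 0 + (u x - u 0). The constant part has an explicit antiderivative, and
  the rest is O(x), hence continuous after multiplication by ln. This justifies cutting the integral
  over [-a, a] at 0.\<close>

lemma ln_mult_integrable:
  fixes a :: real
  assumes a: "a > 0"
    and der: "\<And>x. x \<in> {0..a} \<Longrightarrow> (u has_real_derivative u' x) (at x within {0..a})"
    and cont: "continuous_on {0..a} u'"
  shows "(\<lambda>x. ln x * u x) integrable_on {0..a}"
proof -
  have "bounded (u' ` {0..a})"
    by (rule compact_imp_bounded[OF compact_continuous_image[OF cont]]) simp
  then obtain B where "\<forall>w\<in>u' ` {0..a}. norm w \<le> B"
    unfolding bounded_iff by (rule exE)
  then have B: "\<bar>u' x\<bar> \<le> B" if "x \<in> {0..a}" for x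
    using that by simp
  have B0: "B \<ge> 0" using B[of 0] a by simp
  define r where "r j = (if j = 0 then (\<lambda>x. u x - u 0) else u')" for j :: nat
  have r: "\<bar>u x - u 0\<bar> \<le> B * x" if "x \<in> {0..a}" for x
  proof -
    have "norm (r 0 x) \<le> B * \<bar>x\<bar> ^ (1 - 0)"
    proof (rule chain_flat_bound[where S = "{0..a}"])
      fix j x assume "j < (1::nat)" "x \<in> {0..a}"
      then show "(r j has_vector_derivative r (Suc j) x) (at x within {0..a})"
        using DERIV_diff[OF der DERIV_const] by (simp add: r_def has_real_derivative_iff_has_vector_derivative)
    qed (use that a B in \<open>auto simp: r_def\<close>)
    then show ?thesis using that by (simp add: r_def)
  qed
  have "continuous_on {0..a} (\<lambda>x. ln x * (u x - u 0))"
  proof (rule continuous_on_from_sqrt_bound)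
    fix x assume x: "0 < x" "x \<le> a"
    have "continuous (at x within {0..a}) u"
      using der[of x] x by (intro DERIV_continuous) auto
    then show "continuous (at x within {0..a}) (\<lambda>x. ln x * (u x - u 0))"
      using x by (intro continuous_intros) auto
  next
    fix x assume x: "0 \<le> x" "x \<le> a"
    show "\<bar>ln x * (u x - u 0)\<bar> \<le> (2 * (1 + a) * B) * sqrt x"
    proof (cases "x = 0")
      case False
      then have "\<bar>ln x\<bar> * \<bar>u x - u 0\<bar> \<le> (2 * (1 + a) / sqrt x) * (B * x)"
        using x a by (intro mult_mono abs_ln_le_sqrt r) auto
      also have "\<dots> = (2 * (1 + a) * B) * (x / sqrt x)" by simp
      also have "x / sqrt x = sqrt x" using x(1) by (rule real_div_sqrt)
      finally show ?thesis by (simp add: abs_mult)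
    qed simp
  qed
  then have "(\<lambda>x. ln x * (u x - u 0)) integrable_on {0..a}"
    by (rule integrable_continuous_real)
  moreover have "(\<lambda>x. ln x * x ^ (2*0)) integrable_on {0..a}"
    using log_chain_0_integral[OF a] by (rule has_integral_integrable)
  then have "(\<lambda>x. u 0 * (ln x * x ^ (2*0))) integrable_on {0..a}"
    using integrable_on_mult_right by blast
  ultimately have "(\<lambda>x. ln x * (u x - u 0) + u 0 * (ln x * x ^ (2*0))) integrable_on {0..a}"
    by (rule integrable_add)
  then show ?thesis by (simp add: algebra_simps)
qed

lemma integral_symmetric:
  fixes f :: "real \<Rightarrow> real"
  assumes "a > 0" and f: "f integrable_on {0..a}" and g: "(\<lambda>x. f (- x)) integrable_on {0..a}"
  shows "integral {- a..a} f = integral {0..a} (\<lambda>x. f x + f (- x))"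
proof -
  have "((\<lambda>x. f (- x)) has_integral integral {0..a} (\<lambda>x. f (- x))) {- 0.. - (- a)}"
    using g by (simp add: integrable_integral)
  then have "(f has_integral integral {0..a} (\<lambda>x. f (- x))) {- a..0}"
    using has_integral_reflect_real[of f "integral {0..a} (\<lambda>x. f (- x))" 0 "- a"] by simp
  from has_integral_combine[OF _ _ this integrable_integral[OF f]] assms(1)
  have "(f has_integral integral {0..a} (\<lambda>x. f (- x)) + integral {0..a} f) {- a..a}" by simp
  then show ?thesis
    using integral_add[OF f g] by (simp add: integral_unique)
qed

lemma punctured_trapezoidal_even:
  "punctured_trapezoidal a M g
     = (\<Sum>n=1..M. step_size a M * (g (real n * step_size a M) + g (- (real n * step_size a M))))"
proof -
  define h where "h = step_size a M"
  have split: "{- int M..int M} - {0} = int ` {1..M} \<union> (\<lambda>n. - int n) ` {1..M}"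
  proof (intro equalityI subsetI)
    fix i assume i: "i \<in> {- int M..int M} - {0}"
    show "i \<in> int ` {1..M} \<union> (\<lambda>n. - int n) ` {1..M}"
    proof (cases "i > 0")
      case True
      then have "i = int (nat i)" "nat i \<in> {1..M}" using i by auto
      then show ?thesis by blast
    next
      case False
      then have "i = - int (nat (- i))" "nat (- i) \<in> {1..M}" using i by auto
      then show ?thesis by blast
    qed
  qed auto
  have "punctured_trapezoidal a M g = (\<Sum>n\<in>int ` {1..M}. g (of_int n * h) * h)
      + (\<Sum>n\<in>(\<lambda>n. - int n) ` {1..M}. g (of_int n * h) * h)"
    unfolding punctured_trapezoidal_def split h_def by (rule sum.union_disjoint) auto
  also have "\<dots> = (\<Sum>n=1..M. g (real n * h) * h) + (\<Sum>n=1..M. g (- (real n * h)) * h)"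
    by (subst (1 2) sum.reindex) (auto simp: inj_on_def)
  finally show ?thesis
    by (simp add: h_def algebra_simps sum.distrib)
qed

theorem theorem4:
  fixes a :: real and K p :: nat and s \<tau> \<eta> :: "real \<Rightarrow> real" and w :: "nat \<Rightarrow> real"
  assumes "a > 0"
    and "s = (\<lambda>x. - ln \<bar>x\<bar>)"
    and "smooth_on {- a..a} \<tau>"
    and "p > 2 * K + 1"
    and "\<eta> \<in> C_compact p {- a..a}"
    and "\<forall>x. \<eta> (- x) = \<eta> x"
    and "\<eta> 0 = 1"
    and "\<forall>k\<in>{1..2 * K + 1}. (deriv ^^ k) \<eta> 0 = 0"
    and "\<forall>k\<le>K. complex_of_real (\<Sum>j\<le>K. w j * real j ^ (2 * k))
                  = - deriv riemann_zeta (- of_nat (2 * k))"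
  shows "(\<lambda>M. integral {- a..a} (\<lambda>x. s x * \<tau> x * \<eta> x)
             - (punctured_trapezoidal a M (\<lambda>x. s x * \<tau> x * \<eta> x)
                - \<tau> 0 * step_size a M * ln (step_size a M)
                + step_size a M * (\<Sum>j\<le>K. w j *
                    (\<tau> (real j * step_size a M) + \<tau> (- (real j * step_size a M))))))
         \<in> O(\<lambda>M. step_size a M ^ (2 * K + 2))"
proof -
  note a = \<open>a > 0\<close>
  define q where "q = 2 * K + 2"
  have qp: "q \<le> p" using assms(4) by (simp add: q_def)
  obtain e where e0: "e 0 = \<eta>"
    and e_der: "\<And>j x. j < p \<Longrightarrow> (e j has_real_derivative e (Suc j) x) (at x)"
    and e_cont: "\<And>j. j \<le> p \<Longrightarrow> continuous_on UNIV (e j)"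
    using C_on_chain[of p UNIV \<eta>] assms(5) unfolding C_compact_def by auto
  obtain t where t0: "t 0 = \<tau>"
    and t_der: "\<And>j x. \<lbrakk>j < q; x \<in> {- a..a}\<rbrakk> \<Longrightarrow> (t j has_real_derivative t (Suc j) x) (at x within {- a..a})"
    and t_cont: "\<And>j. j \<le> q \<Longrightarrow> continuous_on {- a..a} (t j)"
    using C_on_chain[of q "{- a..a}" \<tau>] assms(3) unfolding smooth_on_def by blast
  \<comment> \<open>The sign comes from the chain rule under reflection; it makes the odd members
    vanish at 0.\<close>
  define G where "G j x = t j x + (- 1) ^ j * t j (- x)" for j x
  define F where "F = leibniz e G"
  have t_der': "(t j has_real_derivative t (Suc j) x) (at x within {0..a})"
    and t_ref: "((\<lambda>x. t j (- x)) has_real_derivative - t (Suc j) (- x)) (at x within {0..a})"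
    if "j < q" "x \<in> {0..a}" for j x
  proof -
    show "(t j has_real_derivative t (Suc j) x) (at x within {0..a})"
      using that a by (intro DERIV_subset[OF t_der]) auto
    have "(t j has_real_derivative t (Suc j) (- x)) (at (- x) within uminus ` {0..a})"
      using that by (intro DERIV_subset[OF t_der]) auto
    moreover have "(uminus has_real_derivative - 1) (at x within {0..a})"
      by (auto intro!: derivative_eq_intros)
    ultimately have "((t j \<circ> uminus) has_real_derivative t (Suc j) (- x) * - 1) (at x within {0..a})"
      by (rule DERIV_image_chain)
    then show "((\<lambda>x. t j (- x)) has_real_derivative - t (Suc j) (- x)) (at x within {0..a})"
      by (simp add: o_def)
  qed
  have e_der': "(e j has_real_derivative e (Suc j) x) (at x within S)" if "j < q" for j x S
    using e_der qp that by (auto intro: has_field_derivative_at_within)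
  have G_der: "(G j has_real_derivative G (Suc j) x) (at x within {0..a})" if "j < q" "x \<in> {0..a}" for j x
  proof -
    have "((\<lambda>x. t j x + (- 1) ^ j * t j (- x)) has_real_derivative
        t (Suc j) x + (- 1) ^ j * (- t (Suc j) (- x))) (at x within {0..a})"
      by (intro DERIV_add DERIV_cmult t_der' t_ref that)
    then show ?thesis by (simp add: G_def[abs_def])
  qed
  have t_cont': "continuous_on {0..a} (t j)" "continuous_on {0..a} (\<lambda>x. t j (- x))" if "j \<le> q" for j
  proof -
    show "continuous_on {0..a} (t j)"
      using a by (intro continuous_on_subset[OF t_cont[OF that]]) auto
    show "continuous_on {0..a} (\<lambda>x. t j (- x))"
      by (rule continuous_on_compose2[OF t_cont[OF that]]) (auto intro!: continuous_intros)
  qed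
  have e_cont': "continuous_on S (e j)" if "j \<le> q" for j S
    using e_cont[of j] qp that continuous_on_subset by auto
  have G_cont: "continuous_on {0..a} (G j)" if "j \<le> q" for j
    unfolding G_def[abs_def] by (intro continuous_intros t_cont' that)
  have F_der: "(F j has_real_derivative F (Suc j) x) (at x within {0..a})" if "j < q" "x \<in> {0..a}" for j x
    unfolding F_def using that by (intro leibniz_deriv e_der' G_der) auto
  have F_cont: "continuous_on {0..a} (F q)"
    unfolding F_def leibniz_def[abs_def] by (intro continuous_intros e_cont' G_cont) auto
  have e_flat: "e j 0 = (if j = 0 then 1 else 0)" if "j < q" for j
  proof (cases j)
    case (Suc i)
    have "(deriv ^^ j) (e 0) = e j"
      by (rule higher_deriv_chain[where u = e and p = p]) (use that qp e_der in auto)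
    moreover have "(deriv ^^ j) \<eta> 0 = 0" by (rule bspec[OF assms(8)]) (use that Suc in \<open>auto simp: q_def\<close>)
    ultimately show ?thesis using Suc e0 by simp
  qed (use e0 assms(7) in simp)
  \<comment> \<open>Only the term with eta undifferentiated survives, so F and G have the same
    derivatives at 0 below order q.\<close>
  have F_at_0: "F j 0 = G j 0" if "j < q" for j
  proof -
    have "F j 0 = (\<Sum>i\<le>j. if i = 0 then G j 0 else 0)"
      unfolding F_def leibniz_def using that e_flat by (intro sum.cong) auto
    then show ?thesis by simp
  qed
  have G_odd: "G j 0 = 0" if "odd j" for j using that by (simp add: G_def)
  have F_odd: "F j 0 = 0" if "j < q" "odd j" for j using F_at_0[OF that(1)] G_odd[OF that(2)] by simp
  have eta_out: "e 0 x = 0" if "x > a" for x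
  proof (rule ccontr)
    assume "e 0 x \<noteq> 0"
    then have "x \<in> closure {x. \<eta> x \<noteq> 0}" using e0 by (intro subsetD[OF closure_subset]) auto
    then show False using assms(5) that by (auto simp: C_compact_def)
  qed
  have e_a: "e j a = 0" if "j < q" for j
    by (rule chain_vanishes_at_boundary[where u = e and p = p]) (use that qp e_der eta_out in auto)
  have F_flat: "F j a = 0" if "j < q" for j
    unfolding F_def leibniz_def using that e_a by (intro sum.neutral) auto
  \<comment> \<open>The left-hand side of the linear system; the system identifies it with
    -zeta'(-2k) and shows that this value is real.\<close>
  define Z where "Z k = (\<Sum>j\<le>K. w j * real j ^ (2 * k))" for k
  have Z: "- deriv riemann_zeta (- of_nat (2 * k)) = complex_of_real (Z k)" if "k \<le> K" for k
    using assms(9) that by (simp add: Z_def)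
  obtain C where C: "\<And>M. M \<ge> 1 \<Longrightarrow> \<bar>(\<Sum>n=1..M. step_size a M * (ln (real n * step_size a M) * F 0 (real n * step_size a M)))
            - integral {0..a} (\<lambda>x. ln x * F 0 x)
            - ((\<Sum>k\<le>K. even_coeff F k * (step_size a M ^ (2*k+1) * Z k)) - F 0 0 * (step_size a M * ln (step_size a M)) / 2)\<bar>
          \<le> C * step_size a M ^ q"
    using em_ln_core[where F = F, OF q_def a F_der F_cont F_odd F_flat Z] by blast
  \<comment> \<open>A second expansion, for G, because the correction terms carry tau without the
    factor eta.\<close>
  obtain B where B0: "B \<ge> 0" and B: "\<And>j x. \<lbrakk>j \<le> q; 0 \<le> x; x \<le> a\<rbrakk> \<Longrightarrow> \<bar>even_rem K G j x\<bar> \<le> B * x ^ (q - j)"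
    using even_rem_bound[where u = G, OF q_def a G_der G_cont[OF order_refl] G_odd] by blast
  have coeff: "even_coeff F k = even_coeff G k" if "k \<le> K" for k
    using that F_at_0[of "2*k"] by (simp add: even_coeff_def q_def)
  have F00: "F 0 0 = 2 * \<tau> 0" using F_at_0[of 0] by (simp add: q_def G_def t0)
  have F0: "F 0 x = \<eta> x * (\<tau> x + \<tau> (- x))" for x by (simp add: F_def G_def e0 t0)
  define f where "f x = s x * \<tau> x * \<eta> x" for x
  have f_pair: "f x + f (- x) = - (ln x * F 0 x)" if "x \<ge> 0" for x
    using that assms(6) by (simp add: f_def assms(2) F0 algebra_simps)
  have I: "integral {- a..a} f = - integral {0..a} (\<lambda>x. ln x * F 0 x)"
  proof -
    have "(\<lambda>x. ln x * (e 0 x * t 0 x)) integrable_on {0..a}"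
      by (rule ln_mult_integrable[OF a DERIV_mult'[OF e_der' t_der']])
         (auto simp: q_def intro!: continuous_intros e_cont' t_cont')
    then have "(\<lambda>x. - (ln x * (e 0 x * t 0 x))) integrable_on {0..a}" by (rule integrable_neg)
    then have 1: "f integrable_on {0..a}"
      by (rule integrable_eq) (simp add: f_def assms(2) e0 t0)
    have "(\<lambda>x. ln x * (e 0 x * t 0 (- x))) integrable_on {0..a}"
      by (rule ln_mult_integrable[OF a DERIV_mult'[OF e_der' t_ref]])
         (auto simp: q_def intro!: continuous_intros e_cont' t_cont')
    then have "(\<lambda>x. - (ln x * (e 0 x * t 0 (- x)))) integrable_on {0..a}" by (rule integrable_neg)
    then have 2: "(\<lambda>x. f (- x)) integrable_on {0..a}"
      by (rule integrable_eq) (simp add: f_def assms(2,6) e0 t0)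
    have "integral {- a..a} f = integral {0..a} (\<lambda>x. f x + f (- x))"
      by (rule integral_symmetric[OF a 1 2])
    also have "\<dots> = integral {0..a} (\<lambda>x. - (ln x * F 0 x))"
      by (rule integral_cong) (simp add: f_pair)
    finally show ?thesis by simp
  qed
  have T: "punctured_trapezoidal a M f = - (\<Sum>n=1..M. step_size a M * (ln (real n * step_size a M) * F 0 (real n * step_size a M)))" for M
    unfolding punctured_trapezoidal_even using step_size_pos[OF a, of M]
    by (simp add: f_pair flip: sum_negf)
  \<comment> \<open>The factor 2 a bounds the h in front of the correction sum.\<close>
  define D where "D = C + a * (\<Sum>j\<le>K. \<bar>w j\<bar> * (B * real j ^ q)) * 2"
  show ?thesis
  \<comment> \<open>M >= K + 1 keeps the points j h with j <= K inside [0, a], and includes M >= 1,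
    on which \<open>C\<close> depends.\<close>
  proof (rule bigoI[of _ D], rule eventually_mono[OF eventually_ge_at_top[of "Suc K"]])
    fix M assume M: "Suc K \<le> M"
    define h where "h = step_size a M"
    have h: "h > 0" unfolding h_def using a by (rule step_size_pos)
    have hM: "real M * h + h / 2 = a"
      using step_size_mult[of M a] by (simp add: h_def distrib_right)
    have h2: "h \<le> a * 2" using hM h mult_nonneg_nonneg[of "real M" h] by linarith
    define S where "S = (\<Sum>n=1..M. h * (ln (real n * h) * F 0 (real n * h)))"
    define J where "J = integral {0..a} (\<lambda>x. ln x * F 0 x)"
    define V where "V = (\<Sum>k\<le>K. even_coeff G k * (h ^ (2*k+1) * Z k))"
    have 1: "\<bar>S - J - (V - \<tau> 0 * (h * ln h))\<bar> \<le> C * h ^ q"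
    proof -
      have "V = (\<Sum>k\<le>K. even_coeff F k * (h ^ (2*k+1) * Z k))"
        unfolding V_def by (intro sum.cong) (auto simp: coeff)
      then show ?thesis using C[of M] M by (simp add: S_def J_def h_def F00)
    qed
    have G_exp: "G 0 x = even_rem K G 0 x + (\<Sum>k\<le>K. even_coeff G k * x ^ (2*k))" for x
      using pow_chain_1 by (simp add: even_rem_def)
    have 2: "\<bar>h * (\<Sum>j\<le>K. w j * G 0 (real j * h)) - V\<bar> \<le> (a * 2 * (\<Sum>j\<le>K. \<bar>w j\<bar> * (B * real j ^ q))) * h ^ q"
    proof -
      have "h * (\<Sum>j\<le>K. w j * G 0 (real j * h))
          = h * (\<Sum>j\<le>K. w j * even_rem K G 0 (real j * h)) + (\<Sum>k\<le>K. \<Sum>j\<le>K. h * (w j * (even_coeff G k * (real j * h) ^ (2*k))))"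
        unfolding G_exp distrib_left sum.distrib sum_distrib_left by (subst (2) sum.swap) simp
      \<comment> \<open>Summing over j first turns w_j j^(2k) into \<open>Z k\<close>: the
        polynomial part of the correction is exactly the zeta part \<open>V\<close> of the
        trapezoidal error, so the two cancel.\<close>
      also have "(\<Sum>k\<le>K. \<Sum>j\<le>K. h * (w j * (even_coeff G k * (real j * h) ^ (2*k)))) = V"
        unfolding V_def Z_def sum_distrib_left
        by (intro sum.cong refl) (simp add: power_mult_distrib mult_ac)
      finally have "\<bar>h * (\<Sum>j\<le>K. w j * G 0 (real j * h)) - V\<bar> = h * \<bar>\<Sum>j\<le>K. w j * even_rem K G 0 (real j * h)\<bar>"
        using h by (simp add: abs_mult)
      also have "\<dots> \<le> (a * 2) * (\<Sum>j\<le>K. \<bar>w j\<bar> * (B * real j ^ q) * h ^ q)"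
      proof (intro mult_mono h2 order_trans[OF sum_abs] sum_mono)
        fix j assume "j \<in> {..K}"
        then have "real j * h \<le> real M * h" using M h by simp
        then have "real j * h \<le> a" using hM h by linarith
        then have "\<bar>even_rem K G 0 (real j * h)\<bar> \<le> B * (real j * h) ^ (q - 0)"
          using h by (intro B) auto
        then have "\<bar>w j\<bar> * \<bar>even_rem K G 0 (real j * h)\<bar> \<le> \<bar>w j\<bar> * (B * (real j * h) ^ q)"
          by (intro mult_left_mono) auto
        then show "\<bar>w j * even_rem K G 0 (real j * h)\<bar> \<le> \<bar>w j\<bar> * (B * real j ^ q) * h ^ q"
          by (simp add: abs_mult power_mult_distrib mult_ac)
      qed (use a in auto)
      finally show ?thesis by (simp add: sum_distrib_right mult.assoc)
    qed
    have "integral {- a..a} f - (punctured_trapezoidal a M f - \<tau> 0 * h * ln h + h * (\<Sum>j\<le>K. w j * (\<tau> (real j * h) + \<tau> (- (real j * h)))))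
        = (S - J - (V - \<tau> 0 * (h * ln h))) - (h * (\<Sum>j\<le>K. w j * G 0 (real j * h)) - V)"
      unfolding I T S_def J_def h_def[symmetric] by (simp add: G_def t0)
    also have "norm \<dots> \<le> C * h ^ q + (a * 2 * (\<Sum>j\<le>K. \<bar>w j\<bar> * (B * real j ^ q))) * h ^ q"
      using 1 2 unfolding real_norm_def by linarith
    also have "\<dots> = D * norm (h ^ q)"
      using h by (simp add: D_def algebra_simps)
    finally show "norm (integral {- a..a} (\<lambda>x. s x * \<tau> x * \<eta> x)
             - (punctured_trapezoidal a M (\<lambda>x. s x * \<tau> x * \<eta> x)
                - \<tau> 0 * step_size a M * ln (step_size a M)
                + step_size a M * (\<Sum>j\<le>K. w j *
                    (\<tau> (real j * step_size a M) + \<tau> (- (real j * step_size a M))))))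
          \<le> D * norm (step_size a M ^ (2 * K + 2))"
      unfolding f_def h_def q_def .
  qed
qed

end
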